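(* For every real number $x$, $$\mathbb{P}_n\bigl(\log \mathbf{N}_n \le \mu_n + x\,\sigma_n\bigr) = \Phi(x) + o(1)\qquad (n\to\infty),$$ where $\mathbb{P}_n$ is the uniform probability measure on the symmetric group $S_n$, $\mathbf{N}_n(\pi)$ is the number of ordered pairs $(\tau_1,\tau_2)$ of involutions of $[n]$ with $\pi=\tau_2\circ\tau_1$, $\mu_n=\sum_{k=1}^n \frac{\log k}{k}$, $\sigma_n=\Bigl(\sum_{k=1}^n \frac{\log^2 k}{k}\Bigr)^{1/2}$, and $\Phi(x)=\frac{1}{\sqrt{2\pi}}\int_{-\infty}^x e^{-t^2/2}\,dt$.
   Context: $[n]=\{1,\dots,n\}$ and $S_n$ is the group of permutations of $[n]$. An involution of $[n]$ is a permutation $\tau$ of $[n]$ that is its own inverse, i.e. $\tau\circ\tau=\mathrm{id}$ (all cycle lengths are at most two; in particular the identity counts as an involution). For $\pi\in S_n$, $\mathbf{N}_n(\pi)$ is the number of ordered pairs $(\tau_1,\tau_2)$ of involutions of $[n]$ such that $\pi=\tau_2\circ\tau_1$; it is regarded as a random variable on $S_n$ under the uniform measure $\mathbb{P}_n$. The numbers $\sigma_n$ are real normalizing constants (not permutations). *)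

theory Defs
  imports "HOL-Probability.Probability" "HOL-Combinatorics.Permutations"
begin

text \<open>Permutations of \<open>[n]\<close> are functions on \<^typ>\<open>nat\<close> that fix every point outside \<open>{1..n}\<close>.\<close>

definition Sym :: "nat \<Rightarrow> (nat \<Rightarrow> nat) set" where
  "Sym n = {\<pi>. \<pi> permutes {1..n}}"

definition involutions :: "nat \<Rightarrow> (nat \<Rightarrow> nat) set" where
  "involutions n = {\<tau> \<in> Sym n. \<tau> \<circ> \<tau> = id}"

definition N_inv :: "nat \<Rightarrow> (nat \<Rightarrow> nat) \<Rightarrow> nat" where
  "N_inv n \<pi> =
     card {(\<tau>1, \<tau>2). \<tau>1 \<in> involutions n \<and> \<tau>2 \<in> involutions n \<and> \<pi> = \<tau>2 \<circ> \<tau>1}"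

definition P_unif :: "nat \<Rightarrow> (nat \<Rightarrow> nat) pmf" where
  "P_unif n = pmf_of_set (Sym n)"

definition mu_seq :: "nat \<Rightarrow> real" where
  "mu_seq n = (\<Sum>k=1..n. ln (real k) / real k)"

definition sigma_seq :: "nat \<Rightarrow> real" where
  "sigma_seq n = sqrt (\<Sum>k=1..n. (ln (real k))\<^sup>2 / real k)"

definition Phi :: "real \<Rightarrow> real" where
  "Phi x = 1 / sqrt (2 * pi) * (LINT t:{..x}|lborel. exp (- t\<^sup>2 / 2))"

end

theory Submission
  imports
    Defs
    "HOL-Combinatorics.Orbits"
    "HOL-Complex_Analysis.Complex_Analysis"
    "HOL-Real_Asymp.Real_Asymp"
begin

text \<open>
  A pair of involutions with product \<open>\<pi>\<close> amounts to an involution that conjugates \<open>\<pi>\<close> to its inverse.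
  Counting these gives \<open>log N = \<Sum> log |C| + R\<close> over the cycles \<open>C\<close> of \<open>\<pi>\<close>, where \<open>R \<ge> 0\<close> comes only from
  pairs of cycles of equal length and has bounded expectation. The cycles longer than
  \<open>b = n / log\<^sup>2 n\<close> contribute \<open>O(log n log log n)\<close> on average, which is negligible compared to \<open>\<sigma>\<^sub>n\<close>, of
  order \<open>(log n) powr (3/2)\<close>. By the exponential formula, the characteristic function of the
  remaining sum is the \<open>n\<close>-th partial sum, at \<open>z = 1\<close>, of the Taylor series of the entire function
  \<open>exp (\<Sum>k\<le>b. (k powr (i\<theta>) - 1) z^k / k)\<close>. Cauchy's inequality on a circle of radius \<open>exp (1/b)\<close>
  shows that this differs from the value of the function at \<open>1\<close>, the characteristic function of a sum
  of independent Poisson variables, by \<open>o(1)\<close>. Levy's continuity theorem finishes the proof.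
\<close>

subsection \<open>Cycles of a uniform permutation\<close>

definition cycle_len :: "('a \<Rightarrow> 'a) \<Rightarrow> 'a \<Rightarrow> nat" where
  "cycle_len p x = card (orbit p x)"

text \<open>\<open>cyclic_on\<close> only constrains \<open>c\<close> on \<open>C\<close>;
  \<open>c permutes C\<close> also fixes every point outside, so that each cycle on a finite
  \<open>C\<close> is counted exactly once.\<close>

definition cycles_on :: "'a set \<Rightarrow> ('a \<Rightarrow> 'a) set" where
  "cycles_on C = {c. c permutes C \<and> cyclic_on c C}"

lemma finite_cycles_on: "finite C \<Longrightarrow> finite (cycles_on C)"
  unfolding cycles_on_def using finite_permutations[of C] by (rule rev_finite_subset) auto

lemma perm_self_in_orbit:
  assumes "finite A" "p permutes A"
  shows "x \<in> orbit p x"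
  using assms permutation_permutes permutation_self_in_orbit by metis

lemma orbit_comp_left:
  assumes "finite A" "C \<subseteq> A" "c permutes C" "q permutes (A - C)" "x \<in> C"
  shows "orbit (c \<circ> q) x = orbit c x"
proof (rule orbit_cong)
  have "finite C" using assms finite_subset by blast
  then show "x \<in> orbit c x" using assms perm_self_in_orbit by metis
  fix s assume "s \<in> orbit c x"
  then have "s \<in> C" using permutes_orbit_subset[OF assms(3,5)] by blast
  then show "(c \<circ> q) s = c s" using permutes_not_in[OF assms(4), of s] by simp
qed

lemma orbit_comp_right:
  assumes "finite A" "C \<subseteq> A" "c permutes C" "q permutes (A - C)" "x \<in> A - C"
  shows "orbit (c \<circ> q) x = orbit q x"
proof (rule orbit_cong)
  have "finite (A - C)" using assms by blast
  then show "x \<in> orbit q x" using assms perm_self_in_orbit by metis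
  fix s assume "s \<in> orbit q x"
  then have "s \<in> A - C" using permutes_orbit_subset[OF assms(4,5)] by blast
  then have "q s \<in> A - C" using permutes_in_image[OF assms(4)] by blast
  then show "(c \<circ> q) s = q s" using permutes_not_in[OF assms(3)] by simp
qed

lemma comp_permutes_split:
  assumes "C \<subseteq> A" "c permutes C" "q permutes (A - C)"
  shows "(c \<circ> q) permutes A"
  using assms by (meson permutes_compose permutes_subset Diff_subset)

text \<open>One half of the bijection behind \<open>sum_permutations_split_orbit\<close>. An orbit
  is closed under \<open>p\<close> and under preimages, so \<open>p\<close> acts separately on
  \<open>C\<close> and on \<open>A - C\<close>.\<close>

lemma perm_restrict_orbit:
  assumes "finite A" "x \<in> A" "p permutes A"
  defines "C \<equiv> orbit p x"
  shows "C \<subseteq> A" "x \<in> C" "perm_restrict p C \<in> cycles_on C"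
    and "perm_restrict p (A - C) permutes (A - C)"
    and "perm_restrict p C \<circ> perm_restrict p (A - C) = p"
proof -
  have cyc: "cyclic_on p C" unfolding C_def by (rule cyclic_on_orbit[OF assms(3,1)])
  show sub: "C \<subseteq> A" unfolding C_def by (rule permutes_orbit_subset[OF assms(3,2)])
  show "x \<in> C" unfolding C_def by (rule perm_self_in_orbit[OF assms(1,3)])
  show "perm_restrict p (A - C) permutes (A - C)"
    using perm_restrict_diff_cyclic assms(3) cyc by blast
  have "perm_restrict p C permutes C"
  proof (rule inj_imp_permutes)
    have "inj_on p C" using permutes_inj_on[OF assms(3)] .
    then show "inj_on (perm_restrict p C) C" by (simp add: perm_restrict_def inj_on_def)
    show "finite C" using sub assms(1) finite_subset by blast
    show "perm_restrict p C y \<in> C" if "y \<in> C" for y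
      using that cyclic_on_inI[OF cyc] by (simp add: perm_restrict_def)
    show "perm_restrict p C y = y" if "y \<notin> C" for y using that by (simp add: perm_restrict_def)
  qed
  then show "perm_restrict p C \<in> cycles_on C"
    using cyc by (simp add: cycles_on_def cyclic_on_perm_restrict)
  have "perm_restrict p C (perm_restrict p (A - C) y) = p y" for y
  proof (cases "y \<in> A")
    case True
    have "p y \<in> C \<Longrightarrow> y \<in> C" using cyclic_on_f_in[OF assms(3) cyc] .
    then show ?thesis using True by (auto simp: perm_restrict_def)
  next
    case False
    then have "y \<notin> C" using sub by blast
    then show ?thesis using False permutes_not_in[OF assms(3)] by (simp add: perm_restrict_def)
  qed
  then show "perm_restrict p C \<circ> perm_restrict p (A - C) = p" by (simp add: fun_eq_iff)
qed

text \<open>The other half of the bijection: the supports of \<open>c\<close> and \<open>q\<close>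
  are disjoint, so \<open>c \<circ> q\<close> acts as \<open>c\<close> on \<open>C\<close> and as
  \<open>q\<close> on \<open>A - C\<close>, and the triple \<open>(C, c, q)\<close> can be read off
  from it.\<close>

lemma perm_restrict_comp_split:
  assumes "finite A" "C \<subseteq> A" "x \<in> C" "c \<in> cycles_on C" "q permutes (A - C)"
  shows "orbit (c \<circ> q) x = C" "perm_restrict (c \<circ> q) C = c" "perm_restrict (c \<circ> q) (A - C) = q"
proof -
  have c: "c permutes C" "cyclic_on c C" using assms(4) by (auto simp: cycles_on_def)
  show "orbit (c \<circ> q) x = C"
    using orbit_comp_left[OF assms(1,2) c(1) assms(5,3)] orbit_cyclic_eq3[OF c(2) assms(3)] by simp
  show "perm_restrict (c \<circ> q) C = c"
  proof
    fix y show "perm_restrict (c \<circ> q) C y = c y"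
      using permutes_not_in[OF assms(5), of y] permutes_not_in[OF c(1), of y]
      by (simp add: perm_restrict_def)
  qed
  show "perm_restrict (c \<circ> q) (A - C) = q"
  proof
    fix y show "perm_restrict (c \<circ> q) (A - C) y = q y"
      using permutes_not_in[OF assms(5), of y] permutes_not_in[OF c(1), of "q y"]
        permutes_in_image[OF assms(5), of y]
      by (auto simp add: perm_restrict_def)
  qed
qed

text \<open>This is conditioning on the cycle through \<open>x\<close>: a permutation amounts to the
  orbit \<open>C\<close> of \<open>x\<close>, a single cycle on \<open>C\<close> and an arbitrary
  permutation of the rest.\<close>

lemma sum_permutations_split_orbit:
  fixes f :: "('a \<Rightarrow> 'a) \<Rightarrow> 'b::comm_monoid_add"
  assumes "finite A" "x \<in> A"
  shows "(\<Sum>p | p permutes A. f p) =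
    (\<Sum>C | C \<subseteq> A \<and> x \<in> C. \<Sum>c\<in>cycles_on C. \<Sum>q | q permutes (A - C). f (c \<circ> q))"
proof -
  let ?S = "SIGMA C:{C. C \<subseteq> A \<and> x \<in> C}. cycles_on C \<times> {q. q permutes (A - C)}"
  have fin: "finite C" if "C \<subseteq> A" for C using that assms finite_subset by blast
  have "(\<Sum>p | p permutes A. f p) = (\<Sum>(C, c, q)\<in>?S. f (c \<circ> q))"
  proof (rule sum.reindex_bij_witness[where
        i = "\<lambda>(C, c, q). c \<circ> q" and
        j = "\<lambda>p. (orbit p x, perm_restrict p (orbit p x), perm_restrict p (A - orbit p x))"], goal_cases)
    case (1 p)
    then show ?case using perm_restrict_orbit(5)[OF assms, of p] by simp
  next
    case (2 p)
    then show ?case using perm_restrict_orbit(1-4)[OF assms, of p] by simp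
  next
    case (3 t)
    obtain C c q where "t = (C, c, q)" by (cases t)
    with 3 show ?case using perm_restrict_comp_split[OF assms(1), of C x c q] by simp
  next
    case (4 t)
    obtain C c q where "t = (C, c, q)" by (cases t)
    with 4 show ?case using comp_permutes_split[of C A c q] by (simp add: cycles_on_def)
  next
    case (5 p)
    then show ?case using perm_restrict_orbit(5)[OF assms, of p] by simp
  qed
  also have "\<dots> = (\<Sum>C | C \<subseteq> A \<and> x \<in> C. \<Sum>(c, q)\<in>cycles_on C \<times> {q. q permutes (A - C)}. f (c \<circ> q))"
    by (rule sum.Sigma[symmetric]) (use assms fin in \<open>auto intro!: finite_cartesian_product finite_cycles_on finite_permutations\<close>)
  also have "\<dots> = (\<Sum>C | C \<subseteq> A \<and> x \<in> C. \<Sum>c\<in>cycles_on C. \<Sum>q | q permutes (A - C). f (c \<circ> q))"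
    by (simp add: sum.cartesian_product)
  finally show ?thesis .
qed

text \<open>As \<open>x\<close> is forced into \<open>C\<close>, a set of size \<open>k\<close> is
  fixed by its other \<open>k - 1\<close> elements, chosen from \<open>A - {x}\<close>.\<close>

lemma sum_subsets_containing:
  fixes h :: "nat \<Rightarrow> 'b::semiring_1"
  assumes "finite A" "x \<in> A"
  shows "(\<Sum>C | C \<subseteq> A \<and> x \<in> C. h (card C)) =
    (\<Sum>k=1..card A. of_nat ((card A - 1) choose (k - 1)) * h k)"
proof -
  let ?S = "{C. C \<subseteq> A \<and> x \<in> C}"
  have fS: "finite ?S" using assms by (auto intro: finite_subset[of _ "Pow A"])
  have cnt: "card {C \<in> ?S. card C = k} = (card A - 1) choose (k - 1)" if "k \<ge> 1" for k
  proof -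
    have "card {C \<in> ?S. card C = k} = card {D. D \<subseteq> A - {x} \<and> card D = k - 1}"
    proof (rule bij_betw_same_card[of "\<lambda>C. C - {x}"], rule bij_betw_byWitness[where f' = "insert x"])
      show "(\<lambda>C. C - {x}) ` {C \<in> ?S. card C = k} \<subseteq> {D. D \<subseteq> A - {x} \<and> card D = k - 1}"
        using assms finite_subset[of _ A] by (auto simp: card_Diff_singleton)
      have "card (insert x D) = k" if "D \<subseteq> A - {x}" "card D = k - 1" for D
      proof -
        have "finite D" "x \<notin> D" using that assms finite_subset by auto
        then show ?thesis using that \<open>k \<ge> 1\<close> by simp
      qed
      then show "insert x ` {D. D \<subseteq> A - {x} \<and> card D = k - 1} \<subseteq> {C \<in> ?S. card C = k}"
        using assms by auto
    qed auto
    also have "\<dots> = (card A - 1) choose (k - 1)"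
      using n_subsets[of "A - {x}" "k - 1"] assms by simp
    finally show ?thesis .
  qed
  have "(\<Sum>C\<in>?S. h (card C)) = (\<Sum>k\<in>{1..card A}. \<Sum>C | C \<in> ?S \<and> card C = k. h (card C))"
  proof (rule sum.group[symmetric])
    show "card ` ?S \<subseteq> {1..card A}"
    proof (clarsimp)
      fix C assume C: "C \<subseteq> A" "x \<in> C"
      have "finite C" using C assms finite_subset by blast
      moreover have "C \<noteq> {}" using C by blast
      ultimately have "card C > 0" by (simp add: card_gt_0_iff)
      then show "Suc 0 \<le> card C \<and> card C \<le> card A" using C assms card_mono by auto
    qed
  qed (use fS in auto)
  also have "\<dots> = (\<Sum>k=1..card A. of_nat ((card A - 1) choose (k - 1)) * h k)"
    by (rule sum.cong) (use cnt in auto)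
  finally show ?thesis by simp
qed

text \<open>Counting all permutations of \<open>C\<close> by the cycle \<open>D\<close> through
  \<open>x\<close> gives an equation for \<open>fact n\<close> in which, by induction, only the term
  for \<open>D = C\<close> is unknown. The value \<open>fact (n - 1)\<close> also satisfies it,
  since then each of the \<open>n\<close> sizes of \<open>D\<close> contributes
  \<open>fact (n - 1)\<close>.\<close>

lemma card_cycles_on:
  assumes "finite C" "C \<noteq> {}"
  shows "card (cycles_on C) = fact (card C - 1)"
  using assms
proof (induction "card C" arbitrary: C rule: less_induct)
  case less
  define n where "n = card C"
  obtain x where x: "x \<in> C" using less by auto
  have n: "n \<ge> 1" using less n_def by (simp add: Suc_le_eq card_gt_0_iff)
  \<comment> \<open>Sets of size \<open>k\<close> through \<open>x\<close>, times cycles on such a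
    set, times permutations of the rest: the product does not depend on \<open>k\<close>.\<close>
  have term_eq: "fact (k - 1) * fact (n - k) * (n - 1 choose (k - 1)) = (fact (n - 1) :: nat)"
    if "1 \<le> k" "k \<le> n" for k
    using binomial_fact_lemma[of "k - 1" "n - 1"] that by (simp add: mult_ac diff_le_mono)
  have "fact n = (\<Sum>p | p permutes C. 1::nat)"
    using card_permutations[of C n] less n_def by simp
  also have "\<dots> = (\<Sum>D | D \<subseteq> C \<and> x \<in> D. card (cycles_on D) * fact (card (C - D)))"
    by (subst sum_permutations_split_orbit[OF less(2) x], rule sum.cong)
      (use less in \<open>auto simp: card_permutations\<close>)
  also have "\<dots> = card (cycles_on C) + (\<Sum>D | D \<subset> C \<and> x \<in> D. card (cycles_on D) * fact (card (C - D)))"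
  proof -
    have eq: "{D. D \<subseteq> C \<and> x \<in> D} = insert C {D. D \<subset> C \<and> x \<in> D}" using x by auto
    show ?thesis unfolding eq by (subst sum.insert) (use less in \<open>auto intro: finite_subset[of _ "Pow C"]\<close>)
  qed
  also have "(\<Sum>D | D \<subset> C \<and> x \<in> D. card (cycles_on D) * fact (card (C - D))) =
      (\<Sum>D | D \<subset> C \<and> x \<in> D. fact (card D - 1) * fact (n - card D))"
  proof (rule sum.cong[OF refl])
    fix D assume "D \<in> {D. D \<subset> C \<and> x \<in> D}"
    then have D: "D \<subset> C" "x \<in> D" by auto
    then have "finite D" using less finite_subset by blast
    moreover have "card D < card C" using D less psubset_card_mono by blast
    moreover have "card (C - D) = n - card D" using D \<open>finite D\<close> n_def by (simp add: card_Diff_subset)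
    ultimately show "card (cycles_on D) * fact (card (C - D)) = fact (card D - 1) * fact (n - card D)"
      using less.hyps[of D] D by auto
  qed
  finally have "fact n = card (cycles_on C) + (\<Sum>D | D \<subset> C \<and> x \<in> D. fact (card D - 1) * fact (n - card D))" .
  moreover have "fact (n - 1) + (\<Sum>D | D \<subset> C \<and> x \<in> D. fact (card D - 1) * fact (n - card D)) = (fact n :: nat)"
  proof -
    have eq: "{D. D \<subseteq> C \<and> x \<in> D} = insert C {D. D \<subset> C \<and> x \<in> D}" using x by auto
    have "fact (n - 1) + (\<Sum>D | D \<subset> C \<and> x \<in> D. fact (card D - 1) * fact (n - card D))
      = (\<Sum>D | D \<subseteq> C \<and> x \<in> D. fact (card D - 1) * fact (n - card D) :: nat)"
      unfolding eq by (subst sum.insert) (use less n_def in \<open>auto intro: finite_subset[of _ "Pow C"]\<close>)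
    also have "\<dots> = (\<Sum>k=1..n. (n - 1 choose (k - 1)) * (fact (k - 1) * fact (n - k)))"
      using sum_subsets_containing[OF less(2) x, of "\<lambda>k. fact (k - 1) * fact (n - k) :: nat"] n_def by simp
    also have "\<dots> = (\<Sum>k=1..n. fact (n - 1))"
      by (rule sum.cong) (use term_eq in \<open>auto simp: mult_ac\<close>)
    also have "\<dots> = fact n" using n by (simp add: fact_reduce)
    finally show ?thesis .
  qed
  ultimately show ?case using n_def by simp
qed

section \<open>Averages over all permutations, conditioned on one cycle\<close>

text \<open>The length of the cycle through \<open>x\<close> is uniform on
  \<open>{1..card A}\<close>, and given that cycle the rest is a uniform permutation. Here
  \<open>h\<close> is the value of \<open>f\<close> after removal of the cycle, and
  \<open>H k\<close> is the conditional mean for length \<open>k\<close>.\<close>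

lemma sum_permutations_by_orbit:
  fixes f :: "('a \<Rightarrow> 'a) \<Rightarrow> 'b::field_char_0"
  assumes "finite A" "x \<in> A"
    and f: "\<And>C c q. C \<subseteq> A \<Longrightarrow> x \<in> C \<Longrightarrow> c permutes C \<Longrightarrow> cyclic_on c C \<Longrightarrow> q permutes (A - C) \<Longrightarrow>
      f (c \<circ> q) = h C q"
    and h: "\<And>C. C \<subseteq> A \<Longrightarrow> x \<in> C \<Longrightarrow>
      (\<Sum>q | q permutes (A - C). h C q) = fact (card (A - C)) * H (card C)"
  shows "(\<Sum>p | p permutes A. f p) = fact (card A - 1) * (\<Sum>k=1..card A. H k)"
proof -
  define n where "n = card A"
  have "(\<Sum>p | p permutes A. f p) =
      (\<Sum>C | C \<subseteq> A \<and> x \<in> C. \<Sum>c\<in>cycles_on C. \<Sum>q | q permutes (A - C). f (c \<circ> q))"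
    by (rule sum_permutations_split_orbit[OF assms(1,2)])
  also have "\<dots> = (\<Sum>C | C \<subseteq> A \<and> x \<in> C. fact (card C - 1) * fact (n - card C) * H (card C))"
  proof (rule sum.cong[OF refl])
    fix C assume "C \<in> {C. C \<subseteq> A \<and> x \<in> C}"
    then have C: "C \<subseteq> A" "x \<in> C" by auto
    have fin: "finite C" "C \<noteq> {}" using C assms(1) finite_subset by auto
    have "(\<Sum>c\<in>cycles_on C. \<Sum>q | q permutes (A - C). f (c \<circ> q)) =
        (\<Sum>c\<in>cycles_on C. \<Sum>q | q permutes (A - C). h C q)"
    proof (rule sum.cong[OF refl], rule sum.cong[OF refl])
      fix c q assume "c \<in> cycles_on C" "q \<in> {q. q permutes (A - C)}"
      then show "f (c \<circ> q) = h C q" using f[OF C, of c q] by (simp add: cycles_on_def)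
    qed
    also have "\<dots> = of_nat (card (cycles_on C)) * (fact (card (A - C)) * H (card C))"
      unfolding h[OF C] by simp
    also have "\<dots> = fact (card C - 1) * fact (n - card C) * H (card C)"
      using card_cycles_on[OF fin] C fin by (simp add: n_def card_Diff_subset)
    finally show "(\<Sum>c\<in>cycles_on C. \<Sum>q | q permutes (A - C). f (c \<circ> q)) =
       fact (card C - 1) * fact (n - card C) * H (card C)" .
  qed
  also have "\<dots> = (\<Sum>k=1..n. of_nat (n - 1 choose (k - 1)) * (fact (k - 1) * fact (n - k) * H k))"
    using sum_subsets_containing[OF assms(1,2), of "\<lambda>k. fact (k - 1) * fact (n - k) * H k"] n_def by simp
  also have "\<dots> = (\<Sum>k=1..n. fact (n - 1) * H k)"
  proof (rule sum.cong[OF refl])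
    fix k assume k: "k \<in> {1..n}"
    have "fact (k - 1) * fact (n - k) * (n - 1 choose (k - 1)) = (fact (n - 1) :: nat)"
      using binomial_fact_lemma[of "k - 1" "n - 1"] k by (simp add: mult_ac diff_le_mono)
    from arg_cong[OF this, of "of_nat :: nat \<Rightarrow> 'b"]
    have "fact (k - 1) * fact (n - k) * of_nat (n - 1 choose (k - 1)) = (fact (n - 1) :: 'b)"
      by (simp only: of_nat_fact of_nat_mult)
    then show "of_nat (n - 1 choose (k - 1)) * (fact (k - 1) * fact (n - k) * H k) = fact (n - 1) * H k"
      by (simp only: mult.assoc[symmetric]) (simp only: mult.commute mult.left_commute)
  qed
  finally show ?thesis by (simp add: n_def sum_distrib_left)
qed

lemma cycle_len_comp_left:
  assumes "finite A" "C \<subseteq> A" "c permutes C" "cyclic_on c C" "q permutes (A - C)" "x \<in> C"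
  shows "orbit (c \<circ> q) x = C" "cycle_len (c \<circ> q) x = card C"
  using orbit_comp_left[of A C c q x] orbit_cyclic_eq3[of c C x] assms by (auto simp: cycle_len_def)

lemma cycle_len_comp_right:
  assumes "finite A" "C \<subseteq> A" "c permutes C" "q permutes (A - C)" "x \<in> A - C"
  shows "cycle_len (c \<circ> q) x = cycle_len q x"
  using orbit_comp_right[of A C c q x] assms by (auto simp: cycle_len_def)

lemma sum_cycle_len:
  fixes g :: "nat \<Rightarrow> 'b::field_char_0"
  assumes "finite A" "x \<in> A"
  shows "(\<Sum>p | p permutes A. g (cycle_len p x)) = fact (card A - 1) * (\<Sum>k=1..card A. g k)"
proof (rule sum_permutations_by_orbit[where h = "\<lambda>C q. g (card C)"])
  show "(\<Sum>q | q permutes (A - C). g (card C)) = fact (card (A - C)) * g (card C)"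
    if "C \<subseteq> A" "x \<in> C" for C using assms by (simp add: card_permutations)
qed (use assms in \<open>simp_all add: cycle_len_comp_left\<close>)

lemma sum_sum_cycle_len:
  fixes g :: "nat \<Rightarrow> 'b::field_char_0"
  assumes "finite A"
  shows "(\<Sum>p | p permutes A. \<Sum>x\<in>A. g (cycle_len p x)) = fact (card A) * (\<Sum>k=1..card A. g k)"
proof -
  have "(\<Sum>p | p permutes A. \<Sum>x\<in>A. g (cycle_len p x)) =
      (\<Sum>x\<in>A. \<Sum>p | p permutes A. g (cycle_len p x))" by (rule sum.swap)
  also have "\<dots> = (\<Sum>x\<in>A. fact (card A - 1) * (\<Sum>k=1..card A. g k))"
    by (rule sum.cong[OF refl]) (rule sum_cycle_len[OF assms])
  also have "\<dots> = of_nat (card A) * (fact (card A - 1) * (\<Sum>k=1..card A. g k))"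
    by simp
  also have "\<dots> = fact (card A) * (\<Sum>k=1..card A. g k)"
    by (cases "card A") (simp_all add: algebra_simps)
  finally show ?thesis .
qed

text \<open>The exponential formula in recursive form. A cycle of length \<open>k\<close> has total
  weight \<open>v k ^ k\<close>; removing the cycle through one point turns the mean over
  \<open>n\<close> points into the assumed recurrence, which is that of the coefficients of the
  exponential of the series with terms \<open>v k ^ k * z ^ k / k\<close>.\<close>

lemma sum_prod_cycle_len:
  fixes v :: "nat \<Rightarrow> 'b::field_char_0"
  assumes "finite A" and e0: "e 0 = 1"
    and e: "\<And>n. of_nat n * e n = (\<Sum>k=1..n. v k ^ k * e (n - k))"
  shows "(\<Sum>p | p permutes A. \<Prod>x\<in>A. v (cycle_len p x)) = fact (card A) * e (card A)"
  using assms(1)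
proof (induction "card A" arbitrary: A rule: less_induct)
  case less
  show ?case
  proof (cases "A = {}")
    case True
    then show ?thesis by (simp add: e0)
  next
    case False
    then obtain x where x: "x \<in> A" by auto
    have "(\<Sum>p | p permutes A. \<Prod>y\<in>A. v (cycle_len p y)) =
      fact (card A - 1) * (\<Sum>k=1..card A. v k ^ k * e (card A - k))"
    proof (rule sum_permutations_by_orbit[OF less(2) x, where
          h = "\<lambda>C q. v (card C) ^ card C * (\<Prod>y\<in>A - C. v (cycle_len q y))"])
      fix C c q assume C: "C \<subseteq> A" "x \<in> C" and c: "c permutes C" "cyclic_on c C"
        and q: "q permutes (A - C)"
      have "(\<Prod>y\<in>A. v (cycle_len (c \<circ> q) y)) =
          (\<Prod>y\<in>A - C. v (cycle_len (c \<circ> q) y)) * (\<Prod>y\<in>C. v (cycle_len (c \<circ> q) y))"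
        using prod.subset_diff[OF C(1) less(2)] .
      also have "(\<Prod>y\<in>A - C. v (cycle_len (c \<circ> q) y)) = (\<Prod>y\<in>A - C. v (cycle_len q y))"
        by (rule prod.cong) (use cycle_len_comp_right[OF less(2) C(1) c(1) q] in auto)
      also have "(\<Prod>y\<in>C. v (cycle_len (c \<circ> q) y)) = v (card C) ^ card C"
        using cycle_len_comp_left[OF less(2) C(1) c q] by simp
      finally show "(\<Prod>y\<in>A. v (cycle_len (c \<circ> q) y)) =
        v (card C) ^ card C * (\<Prod>y\<in>A - C. v (cycle_len q y))" by (simp only: mult.commute)
    next
      fix C assume C: "C \<subseteq> A" "x \<in> C"
      have "A - C \<subset> A" using C x by blast
      then have "card (A - C) < card A" using less(2) psubset_card_mono by blast
      then have "(\<Sum>q | q permutes (A - C). \<Prod>y\<in>A - C. v (cycle_len q y)) = fact (card (A - C)) * e (card (A - C))"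
        using less by simp
      moreover have "card (A - C) = card A - card C" using C less by (meson card_Diff_subset finite_subset)
      ultimately show "(\<Sum>q | q permutes (A - C). v (card C) ^ card C * (\<Prod>y\<in>A - C. v (cycle_len q y))) =
        fact (card (A - C)) * (v (card C) ^ card C * e (card A - card C))"
        by (simp add: sum_distrib_left[symmetric])
    qed
    also have "\<dots> = fact (card A - 1) * (of_nat (card A) * e (card A))" by (simp add: e)
    also have "\<dots> = fact (card A) * e (card A)"
      using False less(2) by (subst (2) fact_reduce) (auto simp: card_gt_0_iff)
    finally show ?thesis .
  qed
qed

text \<open>Given that \<open>x\<close> lies on a \<open>k\<close>-cycle, the rest is a uniform
  permutation of \<open>card A - k\<close> points, in which the expected number of points on
  \<open>k\<close>-cycles is 1 if \<open>k \<le> card A - k\<close> and 0 otherwise.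
  \<open>H\<close> records this case distinction, and the bound forgets it.\<close>

lemma sum_other_cycles_same_len:
  fixes g :: "nat \<Rightarrow> real"
  assumes "finite A" and g: "\<And>k. g k \<ge> 0"
  shows "(\<Sum>p | p permutes A. \<Sum>x\<in>A. g (cycle_len p x) *
      card {y \<in> A - orbit p x. cycle_len p y = cycle_len p x}) \<le> fact (card A) * (\<Sum>k=1..card A. g k)"
proof -
  define H where "H k = (if k \<le> card A - k then g k else 0)" for k
  have *: "(\<Sum>p | p permutes A. g (cycle_len p x) *
      card {y \<in> A - orbit p x. cycle_len p y = cycle_len p x}) = fact (card A - 1) * (\<Sum>k=1..card A. H k)"
    if x: "x \<in> A" for x
  proof (rule sum_permutations_by_orbit[OF assms(1) x, where
        h = "\<lambda>C q. g (card C) * (\<Sum>y\<in>A - C. if cycle_len q y = card C then 1 else 0)"])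
    fix C c q assume C: "C \<subseteq> A" "x \<in> C" and c: "c permutes C" "cyclic_on c C"
      and q: "q permutes (A - C)"
    note l = cycle_len_comp_left[OF assms(1) C(1) c q C(2)]
    have "{y \<in> A - orbit (c \<circ> q) x. cycle_len (c \<circ> q) y = cycle_len (c \<circ> q) x} =
      {y \<in> A - C. cycle_len q y = card C}"
      using l cycle_len_comp_right[OF assms(1) C(1) c(1) q] by auto
    moreover have "real (card {y \<in> A - C. cycle_len q y = card C}) =
      (\<Sum>y\<in>A - C. if cycle_len q y = card C then 1 else 0)"
      using assms(1) by (subst sum.inter_filter[symmetric]) auto
    ultimately show "g (cycle_len (c \<circ> q) x) *
        real (card {y \<in> A - orbit (c \<circ> q) x. cycle_len (c \<circ> q) y = cycle_len (c \<circ> q) x}) =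
      g (card C) * (\<Sum>y\<in>A - C. if cycle_len q y = card C then 1 else 0)"
      using l by simp
  next
    fix C assume C: "C \<subseteq> A" "x \<in> C"
    have fC: "finite C" using C assms finite_subset by blast
    then have k: "card C \<ge> 1" using C by (metis One_nat_def Suc_leI card_gt_0_iff empty_iff)
    have n: "card (A - C) = card A - card C" using C fC by (meson card_Diff_subset)
    have "(\<Sum>q | q permutes (A - C). \<Sum>y\<in>A - C. if cycle_len q y = card C then 1 else 0) =
      fact (card (A - C)) * (\<Sum>k=1..card (A - C). if k = card C then 1 else (0::real))"
      by (rule sum_sum_cycle_len) (use assms in auto)
    also have "(\<Sum>k=1..card (A - C). if k = card C then 1 else (0::real)) =
        (if card C \<le> card A - card C then 1 else 0)"
      using k n by simp
    finally show "(\<Sum>q | q permutes (A - C). g (card C) * (\<Sum>y\<in>A - C. if cycle_len q y = card C then 1 else 0)) =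
      fact (card (A - C)) * H (card C)"
      by (simp add: sum_distrib_left[symmetric] H_def)
  qed
  have "(\<Sum>p | p permutes A. \<Sum>x\<in>A. g (cycle_len p x) *
      card {y \<in> A - orbit p x. cycle_len p y = cycle_len p x}) =
      (\<Sum>x\<in>A. \<Sum>p | p permutes A. g (cycle_len p x) *
      card {y \<in> A - orbit p x. cycle_len p y = cycle_len p x})" by (rule sum.swap)
  also have "\<dots> = of_nat (card A) * (fact (card A - 1) * (\<Sum>k=1..card A. H k))"
    using * by (simp del: One_nat_def)
  also have "\<dots> = fact (card A) * (\<Sum>k=1..card A. H k)"
    by (cases "card A") (simp_all add: algebra_simps)
  also have "\<dots> \<le> fact (card A) * (\<Sum>k=1..card A. g k)"
    by (intro mult_left_mono sum_mono) (auto simp: H_def g)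
  finally show ?thesis .
qed

subsection \<open>Factorisations into two involutions\<close>

text \<open>\<open>t\<close> is the inner factor of a factorisation of \<open>p\<close>; the outer
  one must be \<open>p \<circ> t\<close>. The carrier \<open>A\<close> is arbitrary so that cycles
  can be removed one at a time.\<close>

definition involution_splits :: "'a set \<Rightarrow> ('a \<Rightarrow> 'a) \<Rightarrow> ('a \<Rightarrow> 'a) set" where
  "involution_splits A p = {t. t permutes A \<and> t \<circ> t = id \<and> (p \<circ> t) \<circ> (p \<circ> t) = id}"

lemma N_inv_eq_card_involution_splits:
  assumes "\<pi> permutes {1..n}"
  shows "N_inv n \<pi> = card (involution_splits {1..n} \<pi>)"
  unfolding N_inv_def
proof (rule bij_betw_same_card[of fst], rule bij_betw_byWitness[where f' = "\<lambda>t. (t, \<pi> \<circ> t)"])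
  let ?P = "{(\<tau>1, \<tau>2). \<tau>1 \<in> involutions n \<and> \<tau>2 \<in> involutions n \<and> \<pi> = \<tau>2 \<circ> \<tau>1}"
  have eq: "\<pi> \<circ> \<tau>1 = \<tau>2" if "\<tau>1 \<in> involutions n" "\<pi> = \<tau>2 \<circ> \<tau>1" for \<tau>1 \<tau>2
    using that by (simp add: involutions_def comp_assoc)
  show "\<forall>a\<in>?P. (fst a, \<pi> \<circ> fst a) = a" using eq by auto
  show "fst ` ?P \<subseteq> involution_splits {1..n} \<pi>"
  proof clarify
    fix \<tau>1 \<tau>2 assume t: "\<tau>1 \<in> involutions n" "\<tau>2 \<in> involutions n" and p: "\<pi> = \<tau>2 \<circ> \<tau>1"
    have "\<pi> \<circ> \<tau>1 = \<tau>2" using eq[OF t(1) p] .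
    then show "fst (\<tau>1, \<tau>2) \<in> involution_splits {1..n} (\<tau>2 \<circ> \<tau>1)"
      using t p by (simp add: involution_splits_def involutions_def Sym_def)
  qed
  show "(\<lambda>t. (t, \<pi> \<circ> t)) ` involution_splits {1..n} \<pi> \<subseteq> ?P"
    using assms permutes_compose
    by (auto simp: involution_splits_def involutions_def Sym_def comp_assoc)
qed simp

lemma finite_involution_splits: "finite A \<Longrightarrow> finite (involution_splits A p)"
  unfolding involution_splits_def using finite_permutations[of A] by (rule rev_finite_subset) auto

text \<open>The reflections of a cycle: with the points of the cycle numbered \<open>\<gamma> 0, \<gamma> 1, \<dots>\<close> modulo its
  length \<open>k\<close>, the map \<open>\<gamma> i \<mapsto> \<gamma> (m - i)\<close>, where \<open>-1\<close> is written \<open>k - 1\<close>.\<close>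

lemma card_involution_splits_cycle:
  assumes C: "finite C" and c: "c \<in> cycles_on C"
  shows "card C \<le> card (involution_splits C c)"
proof -
  have c: "c permutes C" "cyclic_on c C" using c by (auto simp: cycles_on_def)
  obtain r where r: "r \<in> C" "C = orbit c r" using c(2) by (auto simp: cyclic_on_def)
  define k where "k = card C"
  define \<gamma> where "\<gamma> i = (c ^^ i) r" for i
  define d where "d = funpow_dist1 c r r"
  have self: "r \<in> orbit c r" using r by simp
  have Cd: "C = \<gamma> ` {0..<d}" using orbit_conv_funpow_dist1[OF self] r by (simp add: \<gamma>_def d_def)
  have inj: "inj_on \<gamma> {0..<d}" using inj_on_funpow_dist1[OF self] by (simp add: \<gamma>_def[abs_def] d_def)
  have dk: "d = k" using card_image[OF inj] Cd by (simp add: k_def)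
  have k0: "k > 0" using dk by (simp add: d_def)
  have per: "(c ^^ k) r = r" unfolding dk[symmetric] d_def by (rule funpow_dist1_prop[OF self])
  have \<gamma>mod: "\<gamma> (i mod k) = \<gamma> i" for i
    unfolding \<gamma>_def using funpow_mod_eq[OF per] by simp
  have \<gamma>cong: "\<gamma> i = \<gamma> j" if "i mod k = j mod k" for i j using that \<gamma>mod by metis
  have \<gamma>C: "\<gamma> i \<in> C" for i
    using \<gamma>mod[of i] k0 Cd dk by (metis atLeastLessThan_iff imageI mod_less_divisor zero_le)
  have cong: "i mod k = j mod k" if "\<gamma> i = \<gamma> j" for i j
  proof -
    have "\<gamma> (i mod k) = \<gamma> (j mod k)" using that \<gamma>mod by simp
    then show ?thesis using inj k0 dk by (auto simp: inj_on_def)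
  qed
  have c\<gamma>: "c (\<gamma> i) = \<gamma> (Suc i)" for i by (simp add: \<gamma>_def)
  \<comment> \<open>An index of \<open>y\<close>, determined only modulo \<open>k\<close>; this
    suffices because \<open>\<gamma>\<close> has period \<open>k\<close>.\<close>
  define ix where "ix y = (SOME i. \<gamma> i = y)" for y
  have ix: "\<gamma> (ix y) = y" if "y \<in> C" for y
  proof -
    have "\<exists>i. \<gamma> i = y" using that Cd by auto
    then show ?thesis unfolding ix_def by (rule someI_ex)
  qed
  define \<tau> where "\<tau> m y = (if y \<in> C then \<gamma> (m + (k - 1) * ix y) else y)" for m y
  have \<tau>\<gamma>: "\<tau> m (\<gamma> i) = \<gamma> (m + (k - 1) * i)" for m i
  proof -
    have "ix (\<gamma> i) mod k = i mod k" by (rule cong) (rule ix[OF \<gamma>C])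
    then have "(m + (k - 1) * ix (\<gamma> i)) mod k = (m + (k - 1) * i) mod k"
      by (intro mod_add_cong mod_mult_cong refl)
    from \<gamma>cong[OF this] show ?thesis by (simp only: \<tau>_def \<gamma>C if_True)
  qed
  have ex: "\<exists>i. y = \<gamma> i" if "y \<in> C" for y using ix[OF that, symmetric] by (rule exI)
  have \<tau>out: "\<tau> m y = y" if "y \<notin> C" for m y using that by (simp add: \<tau>_def)
  have inv: "\<tau> m (\<tau> m y) = y" for m y
  proof (cases "y \<in> C")
    case True
    then obtain i where i: "y = \<gamma> i" using ex by blast
    \<comment> \<open>This says \<open>m - (m - i) = i\<close> modulo \<open>k\<close>. The case
      \<open>k = 1\<close> is separate so that otherwise the multiple of \<open>k\<close> has the
      explicit cofactor \<open>m + l * i\<close>.\<close>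
    have "(m + (k - 1) * (m + (k - 1) * i)) mod k = i mod k"
    proof (cases "k = 1")
      case False
      then obtain l where l: "k = Suc (Suc l)" using k0 by (metis One_nat_def gr0_implies_Suc old.nat.exhaust)
      have "m + (k - 1) * (m + (k - 1) * i) = i + k * (m + l * i)"
        by (simp add: l algebra_simps)
      then show ?thesis by simp
    qed simp
    then show ?thesis unfolding i \<tau>\<gamma> by (rule \<gamma>cong)
  qed (simp add: \<tau>out)
  have \<tau>C: "\<tau> m y \<in> C" if "y \<in> C" for m y using that \<gamma>C by (simp add: \<tau>_def)
  have perm: "\<tau> m permutes C" for m
    unfolding permutes_def
  proof (intro conjI allI impI ex1I)
    show "\<tau> m y = y" if "y \<notin> C" for y using \<tau>out[OF that] .
    show "\<tau> m (\<tau> m y) = y" for y by (rule inv)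
    show "z = \<tau> m y" if "\<tau> m z = y" for y z using inv[of m z] that by simp
  qed
  \<comment> \<open>A rotation after a reflection is again a reflection, so \<open>inv\<close>
    settles both conditions in \<open>involution_splits\<close>.\<close>
  have comp: "c \<circ> \<tau> m = \<tau> (Suc m)" for m
  proof
    fix y show "(c \<circ> \<tau> m) y = \<tau> (Suc m) y"
    proof (cases "y \<in> C")
      case True
      then obtain i where i: "y = \<gamma> i" using ex by blast
      show ?thesis unfolding i by (simp add: \<tau>\<gamma> c\<gamma>)
    next
      case False
      then show ?thesis using permutes_not_in[OF c(1)] by (simp add: \<tau>out)
    qed
  qed
  have "\<tau> m \<in> involution_splits C c" for m
  proof -
    have "\<tau> j \<circ> \<tau> j = id" for j using inv by (simp add: fun_eq_iff)
    then show ?thesis using perm[of m] by (simp only: involution_splits_def comp mem_Collect_eq simp_thms)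
  qed
  then have sub: "\<tau> ` {..<k} \<subseteq> involution_splits C c" by blast
  \<comment> \<open>The \<open>k\<close> reflections differ already at \<open>\<gamma> 0\<close>,
    which is sent to \<open>\<gamma> m\<close>.\<close>
  have "inj_on \<tau> {..<k}"
  proof (rule inj_onI)
    fix m m' assume m: "m \<in> {..<k}" "m' \<in> {..<k}" and "\<tau> m = \<tau> m'"
    then have "\<tau> m (\<gamma> 0) = \<tau> m' (\<gamma> 0)" by simp
    then have "\<gamma> m = \<gamma> m'" by (simp add: \<tau>\<gamma>)
    then show "m = m'" using cong[of m m'] m by simp
  qed
  then have "k = card (\<tau> ` {..<k})" by (simp add: card_image)
  also have "\<dots> \<le> card (involution_splits C c)"
    by (rule card_mono[OF finite_involution_splits[OF C] sub])
  finally show ?thesis by (simp add: k_def)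
qed

section \<open>Lower bound: every cycle contributes a factor of at least its length\<close>

lemma permutes_comp_commute:
  assumes "C \<subseteq> A" "c permutes C" "q permutes (A - C)"
  shows "c \<circ> q = q \<circ> c"
proof
  fix y show "(c \<circ> q) y = (q \<circ> c) y"
    using permutes_not_in[OF assms(2)] permutes_not_in[OF assms(3)]
      permutes_in_image[OF assms(2), of y] permutes_in_image[OF assms(3), of y] assms(1)
    by (cases "y \<in> C"; cases "y \<in> A") auto
qed

text \<open>Splits of \<open>c\<close> and of \<open>q\<close> can be composed: maps supported on
  \<open>C\<close> commute with maps supported on \<open>A - C\<close>, so
  \<open>(c \<circ> q) \<circ> (s \<circ> t)\<close> equals
  \<open>(c \<circ> s) \<circ> (q \<circ> t)\<close>, and a product of commuting involutions is an
  involution. The factors are recovered by looking at \<open>C\<close> and at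
  \<open>A - C\<close>.\<close>

lemma card_involution_splits_comp:
  assumes A: "finite A" and C: "C \<subseteq> A" and c: "c permutes C" and q: "q permutes (A - C)"
  shows "card (involution_splits C c) * card (involution_splits (A - C) q)
    \<le> card (involution_splits A (c \<circ> q))"
proof -
  let ?S = "involution_splits C c \<times> involution_splits (A - C) q"
  have fC: "finite C" using A C finite_subset by blast
  have "inj_on (\<lambda>(s, t). s \<circ> t) ?S"
  proof (rule inj_onI, clarify)
    fix s t s' t' assume st: "s \<in> involution_splits C c" "t \<in> involution_splits (A - C) q"
      "s' \<in> involution_splits C c" "t' \<in> involution_splits (A - C) q" and eq: "s \<circ> t = s' \<circ> t'"
    have p: "s permutes C" "s' permutes C" "t permutes (A - C)" "t' permutes (A - C)"
      using st by (auto simp: involution_splits_def)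
    have "s y = s' y" for y
      using fun_cong[OF eq, of y] permutes_not_in[OF p(1), of y] permutes_not_in[OF p(2), of y]
        permutes_not_in[OF p(3), of y] permutes_not_in[OF p(4), of y]
      by (cases "y \<in> C") auto
    moreover have "t y = t' y" for y
    proof -
      \<comment> \<open>With the order exchanged, a point outside \<open>C\<close> is fixed by the
        inner factor, so the outer one becomes visible.\<close>
      have "t \<circ> s = t' \<circ> s'"
        using eq permutes_comp_commute[OF C p(1,3)] permutes_comp_commute[OF C p(2,4)] by simp
      from fun_cong[OF this, of y] show ?thesis
        using permutes_not_in[OF p(1), of y] permutes_not_in[OF p(2), of y]
          permutes_not_in[OF p(3), of y] permutes_not_in[OF p(4), of y]
        by (cases "y \<in> C") auto
    qed
    ultimately show "s = s' \<and> t = t'" by auto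
  qed
  moreover have "(\<lambda>(s, t). s \<circ> t) ` ?S \<subseteq> involution_splits A (c \<circ> q)"
  proof clarify
    fix s t assume st: "s \<in> involution_splits C c" "t \<in> involution_splits (A - C) q"
    have p: "s permutes C" "t permutes (A - C)" and
      i: "s \<circ> s = id" "t \<circ> t = id" "(c \<circ> s) \<circ> (c \<circ> s) = id" "(q \<circ> t) \<circ> (q \<circ> t) = id"
      using st by (auto simp: involution_splits_def)
    have cs: "c \<circ> s permutes C" and qt: "q \<circ> t permutes (A - C)"
      using c q p permutes_compose by blast+
    have square: "(u \<circ> w) \<circ> (u \<circ> w) = id"
      if "u permutes C" "w permutes (A - C)" "u \<circ> u = id" "w \<circ> w = id" for u w
    proof -
      have "w (u y) = u (w y)" for y
        using fun_cong[OF permutes_comp_commute[OF C that(1,2)], of y] by simp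
      moreover have "u (u y) = y" "w (w y) = y" for y
        using fun_cong[OF that(3), of y] fun_cong[OF that(4), of y] by simp_all
      ultimately show ?thesis by (simp add: fun_eq_iff)
    qed
    have "(c \<circ> q) \<circ> (s \<circ> t) = (c \<circ> s) \<circ> (q \<circ> t)"
      using fun_cong[OF permutes_comp_commute[OF C p(1) q]] by (simp add: fun_eq_iff)
    then show "s \<circ> t \<in> involution_splits A (c \<circ> q)"
      unfolding involution_splits_def
      using square[OF p i(1,2)] square[OF cs qt i(3,4)] comp_permutes_split[OF C p] by simp
  qed
  ultimately have "card ?S \<le> card (involution_splits A (c \<circ> q))"
    using card_inj_on_le finite_involution_splits[OF A] by blast
  then show ?thesis by (simp add: card_cartesian_product)
qed

text \<open>The logarithm of the product of all cycle lengths. Each cycle of length \<open>k\<close>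
  is met at its \<open>k\<close> points, each with weight \<open>1 / k\<close>, so no set of cycles
  has to be formed.\<close>

definition log_cycle_prod :: "'a set \<Rightarrow> ('a \<Rightarrow> 'a) \<Rightarrow> real" where
  "log_cycle_prod A p = (\<Sum>x\<in>A. ln (cycle_len p x) / cycle_len p x)"

text \<open>Remove one cycle at a time; its reflections account for a factor \<open>card C\<close>.
  Positivity is carried along so that the logarithms below are those of positive numbers.\<close>

lemma log_cycle_prod_le:
  assumes "finite A" "p permutes A"
  shows "card (involution_splits A p) > 0 \<and> log_cycle_prod A p \<le> ln (card (involution_splits A p))"
  using assms
proof (induction "card A" arbitrary: A p rule: less_induct)
  case less
  show ?case
  proof (cases "A = {}")
    case True
    then have "involution_splits A p = {id}" using less(3) by (auto simp: involution_splits_def)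
    then show ?thesis using True by (simp add: log_cycle_prod_def)
  next
    case False
    then obtain x where x: "x \<in> A" by auto
    define C where "C = orbit p x"
    define c where "c = perm_restrict p C"
    define q where "q = perm_restrict p (A - C)"
    have C: "C \<subseteq> A" "x \<in> C" and c: "c \<in> cycles_on C" and q: "q permutes (A - C)" and p: "c \<circ> q = p"
      using perm_restrict_orbit[OF less(2) x less(3)] by (auto simp: C_def c_def q_def)
    have c': "c permutes C" "cyclic_on c C" using c by (auto simp: cycles_on_def)
    have fC: "finite C" using C less(2) finite_subset by blast
    then have kpos: "card C > 0" using C by (auto simp: card_gt_0_iff)
    have "A - C \<subset> A" using C x by blast
    then have "card (A - C) < card A" using less(2) psubset_card_mono by blast
    then have IH: "card (involution_splits (A - C) q) > 0"
      "log_cycle_prod (A - C) q \<le> ln (card (involution_splits (A - C) q))"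
      using less(1)[of "A - C" q] less(2) q by auto
    have le: "card C * card (involution_splits (A - C) q) \<le> card (involution_splits A p)"
      using card_involution_splits_comp[OF less(2) C(1) c'(1) q] card_involution_splits_cycle[OF fC c] p
      by (meson le_trans mult_le_mono1)
    have "log_cycle_prod A p = (\<Sum>y\<in>A - C. ln (cycle_len p y) / cycle_len p y)
        + (\<Sum>y\<in>C. ln (cycle_len p y) / cycle_len p y)"
      unfolding log_cycle_prod_def by (rule sum.subset_diff[OF C(1) less(2)])
    also have "(\<Sum>y\<in>A - C. ln (cycle_len p y) / cycle_len p y) = log_cycle_prod (A - C) q"
      unfolding log_cycle_prod_def
      using cycle_len_comp_right[OF less(2) C(1) c'(1) q] p by (intro sum.cong) auto
    also have "(\<Sum>y\<in>C. ln (cycle_len p y) / cycle_len p y) = (\<Sum>y\<in>C. ln (card C) / card C)"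
      using cycle_len_comp_left(2)[OF less(2) C(1) c' q] p by (intro sum.cong) auto
    also have "\<dots> = ln (card C)" using kpos by simp
    also have "log_cycle_prod (A - C) q + ln (card C) \<le>
        ln (card (involution_splits (A - C) q)) + ln (card C)" using IH by simp
    also have "\<dots> = ln (real (card C * card (involution_splits (A - C) q)))"
      using kpos IH by (simp add: ln_mult)
    also have "\<dots> \<le> ln (card (involution_splits A p))"
      using le kpos IH by (intro ln_mono) (auto simp del: of_nat_mult)
    finally show ?thesis using le kpos IH(1) by (metis nat_0_less_mult_iff order_less_le_trans)
  qed
qed

section \<open>Upper bound: the excess comes from distinct cycles of equal length\<close>

lemma orbit_eq_iff:
  assumes "finite A" "p permutes A"
  shows "orbit p x = orbit p y \<longleftrightarrow> x \<in> orbit p y"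
proof
  show "orbit p x = orbit p y \<Longrightarrow> x \<in> orbit p y" using perm_self_in_orbit[OF assms, of x] by simp
  show "x \<in> orbit p y \<Longrightarrow> orbit p x = orbit p y"
    using orbit_cyclic_eq3[OF cyclic_on_orbit[OF assms(2,1)]] by blast
qed

text \<open>An element of \<open>involution_splits A p\<close> conjugates \<open>p\<close> to its inverse, so it maps cycles to cycles
  of the same length and is determined by its values on a set of representatives of the cycles.\<close>

lemma ln_card_involution_splits_le:
  assumes A: "finite A" and p: "p permutes A"
  shows "ln (card (involution_splits A p)) \<le>
    (\<Sum>x\<in>A. ln (card {y \<in> A. cycle_len p y = cycle_len p x}) / cycle_len p x)"
proof -
  \<comment> \<open>The choice depends on \<open>x\<close> only through its orbit, so points of one
    orbit share their representative.\<close>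
  define rep where "rep x = (SOME y. y \<in> orbit p x)" for x
  define R where "R = rep ` A"
  define S where "S x = {y \<in> A. cycle_len p y = cycle_len p x}" for x
  note self = perm_self_in_orbit[OF A p]
  have rep: "rep x \<in> orbit p x" for x unfolding rep_def by (rule someI[of _ x]) (rule self)
  have orep: "orbit p (rep x) = orbit p x" for x
    by (rule orbit_eq_iff[OF A p, THEN iffD2]) (rule rep)
  have orbA: "orbit p x \<subseteq> A" if "x \<in> A" for x using permutes_orbit_subset[OF p that] .
  have RA: "R \<subseteq> A"
  proof
    fix r assume "r \<in> R"
    then obtain x where x: "x \<in> A" "r = rep x" unfolding R_def by blast
    then show "r \<in> A" using rep[of x] orbA[of x] by blast
  qed
  have fR: "finite R" using A by (simp add: R_def)
  have cover: "(\<Union>r\<in>R. orbit p r) = A"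
  proof
    show "(\<Union>r\<in>R. orbit p r) \<subseteq> A" using RA orbA by blast
    show "A \<subseteq> (\<Union>r\<in>R. orbit p r)"
    proof
      fix x assume "x \<in> A"
      then have "rep x \<in> R" unfolding R_def by blast
      moreover have "x \<in> orbit p (rep x)" unfolding orep by (rule self)
      ultimately show "x \<in> (\<Union>r\<in>R. orbit p r)" by blast
    qed
  qed
  have disj: "orbit p r \<inter> orbit p s = {}" if rs: "r \<in> R" "s \<in> R" "r \<noteq> s" for r s
  proof (rule ccontr)
    assume "orbit p r \<inter> orbit p s \<noteq> {}"
    then obtain z where z: "z \<in> orbit p r" "z \<in> orbit p s" by blast
    obtain x y where xy: "r = rep x" "s = rep y" using rs unfolding R_def by blast
    have "orbit p z = orbit p r" "orbit p z = orbit p s"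
      using z orbit_eq_iff[OF A p, of z r] orbit_eq_iff[OF A p, of z s] by simp_all
    then have "orbit p x = orbit p y" unfolding xy orep by simp
    then have "rep x = rep y" by (simp only: rep_def)
    then show False using rs(3) unfolding xy by simp
  qed
  have inj: "inj_on (\<lambda>t. restrict t R) (involution_splits A p)"
  proof (rule inj_onI)
    fix s t assume s: "s \<in> involution_splits A p" and t: "t \<in> involution_splits A p"
      and eq: "restrict s R = restrict t R"
    \<comment> \<open>Since \<open>u\<close> and \<open>p \<circ> u\<close> are involutions,
      \<open>u\<close> conjugates \<open>p\<close> to its inverse; the value at a representative
      therefore propagates along the whole orbit.\<close>
    have conj: "u (p y) = inv p (u y)" if "u \<in> involution_splits A p" for u y
    proof -
      have "((p \<circ> u) \<circ> (p \<circ> u)) (u y) = u y" "(u \<circ> u) y = y"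
        using that by (simp_all add: involution_splits_def)
      then have "p (u (p y)) = u y" by simp
      then show ?thesis using permutes_inverses(2)[OF p] by metis
    qed
    have "s y = t y" for y
    proof (cases "y \<in> A")
      case True
      have r: "rep y \<in> R" using True by (simp add: R_def)
      have "y \<in> orbit p (rep y)" using self orep by simp
      then show ?thesis
      proof (induction rule: orbit.induct)
        case base
        have "s (rep y) = t (rep y)" using fun_cong[OF eq, of "rep y"] r by simp
        then show ?case by (simp add: conj[OF s] conj[OF t])
      next
        case (step z)
        then show ?case by (simp add: conj[OF s] conj[OF t])
      qed
    next
      case False
      have "s permutes A" "t permutes A" using s t by (simp_all add: involution_splits_def)
      then show ?thesis using permutes_not_in[of s A y] permutes_not_in[of t A y] False by simp
    qed
    then show "s = t" by auto
  qed
  have ran: "(\<lambda>t. restrict t R) ` involution_splits A p \<subseteq> PiE R S"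
  proof clarify
    fix t assume t: "t \<in> involution_splits A p"
    have tp: "t permutes A" using t by (simp add: involution_splits_def)
    have conj: "p (t (p y)) = t y" for y
    proof -
      have "((p \<circ> t) \<circ> (p \<circ> t)) (t y) = t y" "(t \<circ> t) y = y"
        using t by (simp_all add: involution_splits_def)
      then show ?thesis by simp
    qed
    have "cycle_len p (t r) = cycle_len p r" for r
    proof -
      have perm: "permutation p" using A p permutation_permutes by blast
      \<comment> \<open>\<open>t\<close> carries a \<open>p\<close>-orbit to an orbit of
        \<open>inv p\<close>, which as a set is a \<open>p\<close>-orbit again.\<close>
      have "t ` orbit p r = orbit (inv p) (t r)"
      proof (rule orbit_inverse[OF self])
        fix y show "inv p (t y) = t (p y)" using conj permutes_inverses(2)[OF p] by metis
      qed
      then have "orbit p (t r) = t ` orbit p r" using orbit_inv_eq[OF perm] by simp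
      then show ?thesis using permutes_inj_on[OF tp] by (simp add: cycle_len_def card_image)
    qed
    then show "restrict t R \<in> PiE R S"
      using RA permutes_in_image[OF tp] by (auto simp: S_def)
  qed
  have finS: "finite (S x)" for x using A by (simp add: S_def)
  have "card (involution_splits A p) \<le> card (PiE R S)"
    using card_inj_on_le[OF inj ran] finite_PiE[OF fR] finS by blast
  also have "\<dots> = (\<Prod>r\<in>R. card (S r))" by (rule card_PiE[OF fR])
  finally have le: "card (involution_splits A p) \<le> (\<Prod>r\<in>R. card (S r))" .
  have Spos: "card (S r) > 0" if "r \<in> R" for r
    using that RA finS by (auto simp: card_gt_0_iff S_def)
  have "ln (card (involution_splits A p)) \<le> ln (real (\<Prod>r\<in>R. card (S r)))"
    using le log_cycle_prod_le[OF A p] by (intro ln_mono) (auto simp del: of_nat_prod)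
  also have "\<dots> = (\<Sum>r\<in>R. ln (card (S r)))"
    unfolding of_nat_prod by (rule ln_prod) (use Spos fR in auto)
  \<comment> \<open>Each representative's term is spread evenly over its orbit; the orbits partition
    \<open>A\<close>, so the choice of representatives disappears.\<close>
  also have "\<dots> = (\<Sum>r\<in>R. \<Sum>x\<in>orbit p r. ln (card (S x)) / cycle_len p x)"
  proof (rule sum.cong[OF refl])
    fix r assume r: "r \<in> R"
    have len: "cycle_len p x = cycle_len p r" if "x \<in> orbit p r" for x
      using that orbit_eq_iff[OF A p, of x r] by (simp add: cycle_len_def)
    have fin: "finite (orbit p r)" using r RA orbA A finite_subset by blast
    have "cycle_len p r > 0" using fin orbit_nonempty[of p r] by (simp add: cycle_len_def card_gt_0_iff)
    then have "ln (card (S r)) = (\<Sum>x\<in>orbit p r. ln (card (S r)) / cycle_len p r)"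
      by (simp add: cycle_len_def)
    also have "\<dots> = (\<Sum>x\<in>orbit p r. ln (card (S x)) / cycle_len p x)"
      by (rule sum.cong) (auto simp: S_def len)
    finally show "ln (card (S r)) = (\<Sum>x\<in>orbit p r. ln (card (S x)) / cycle_len p x)" .
  qed
  also have "\<dots> = (\<Sum>x\<in>(\<Union>r\<in>R. orbit p r). ln (card (S x)) / cycle_len p x)"
  proof (rule sum.UNION_disjoint[symmetric, OF fR])
    show "\<forall>r\<in>R. finite (orbit p r)" using RA orbA A finite_subset by blast
    show "\<forall>r\<in>R. \<forall>s\<in>R. r \<noteq> s \<longrightarrow> orbit p r \<inter> orbit p s = {}" using disj by blast
  qed
  finally show ?thesis unfolding cover by (simp only: S_def)
qed

text \<open>The points on \<open>k\<close>-cycles are the \<open>k\<close> points of the cycle of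
  \<open>x\<close> and the points counted on the right, say \<open>d\<close> of them. Then
  \<open>ln (k + d) - ln k \<le> d / k\<close>, and the weight \<open>1 / k\<close> of each point
  gives the second factor.\<close>

lemma ln_card_involution_splits_diff_le:
  assumes A: "finite A" and p: "p permutes A"
  shows "ln (card (involution_splits A p)) - log_cycle_prod A p \<le>
    (\<Sum>x\<in>A. 1 / (real (cycle_len p x))\<^sup>2 *
      card {y \<in> A - orbit p x. cycle_len p y = cycle_len p x})"
proof -
  have "ln (card {y \<in> A. cycle_len p y = cycle_len p x}) / cycle_len p x - ln (cycle_len p x) / cycle_len p x
      \<le> 1 / (real (cycle_len p x))\<^sup>2 * card {y \<in> A - orbit p x. cycle_len p y = cycle_len p x}"
    if x: "x \<in> A" for x
  proof -
    let ?k = "cycle_len p x" and ?S = "{y \<in> A. cycle_len p y = cycle_len p x}"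
      and ?D = "{y \<in> A - orbit p x. cycle_len p y = cycle_len p x}"
    have sub: "orbit p x \<subseteq> A" using permutes_orbit_subset[OF p x] .
    have fin: "finite (orbit p x)" using sub A finite_subset by blast
    have k: "?k > 0" using fin orbit_nonempty[of p x] by (simp add: cycle_len_def card_gt_0_iff)
    have "cycle_len p y = ?k" if "y \<in> orbit p x" for y
      using that orbit_eq_iff[OF A p, of y x] by (simp add: cycle_len_def)
    then have "?S = orbit p x \<union> ?D" using sub by blast
    moreover have "orbit p x \<inter> ?D = {}" by auto
    ultimately have "card ?S = card (orbit p x) + card ?D"
      using card_Un_disjoint[OF fin, of ?D] A by simp
    then have S: "real (card ?S) = ?k + card ?D" by (simp add: cycle_len_def)
    have "ln (card ?S) - ln ?k = ln (card ?S / ?k)" using k S by (simp add: ln_div)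
    also have "\<dots> \<le> card ?S / ?k - 1" by (rule ln_le_minus_one) (use k S in auto)
    also have "\<dots> = card ?D / ?k" using k S by (simp add: field_simps)
    finally have "(ln (card ?S) - ln ?k) / ?k \<le> card ?D / ?k / ?k"
      by (rule divide_right_mono) simp
    then show ?thesis by (simp add: diff_divide_distrib power2_eq_square)
  qed
  then have "(\<Sum>x\<in>A. ln (card {y \<in> A. cycle_len p y = cycle_len p x}) / cycle_len p x
      - ln (cycle_len p x) / cycle_len p x) \<le> (\<Sum>x\<in>A. 1 / (real (cycle_len p x))\<^sup>2 *
      card {y \<in> A - orbit p x. cycle_len p y = cycle_len p x})" by (rule sum_mono)
  then show ?thesis
    using ln_card_involution_splits_le[OF A p] by (simp add: sum_subtractf log_cycle_prod_def)
qed

subsection \<open>Partial sums of the exponential of a polynomial\<close>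

text \<open>If \<open>f\<close> are the coefficients of the exponential of the series with terms
  \<open>a k * z ^ k / k\<close>, then passing to partial sums divides by \<open>1 - z\<close>.
  Since \<open>1 / (1 - z)\<close> is the exponential of the series with terms
  \<open>z ^ k / k\<close>, this adds 1 to every \<open>a k\<close>.\<close>

lemma exp_partial_sum_recurrence:
  fixes a :: "nat \<Rightarrow> complex" and f :: "nat \<Rightarrow> complex"
  assumes f: "\<And>m. of_nat m * f m = (\<Sum>k=1..m. a k * f (m - k))"
  defines "e \<equiv> \<lambda>n. \<Sum>m\<le>n. f m"
  shows "of_nat n * e n = (\<Sum>k=1..n. (1 + a k) * e (n - k))"
proof -
  \<comment> \<open>Summation by parts.\<close>
  have 1: "(\<Sum>m\<le>n. of_nat m * f m) = of_nat n * e n - (\<Sum>j<n. e j)"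
    by (induction n) (simp_all add: e_def algebra_simps)
  have 2: "(\<Sum>m\<le>n. \<Sum>k=1..m. a k * f (m - k)) = (\<Sum>k=1..n. a k * e (n - k))"
  proof (induction n)
    case (Suc n)
    have "(\<Sum>k=1..Suc n. a k * e (Suc n - k)) = (\<Sum>k=1..n. a k * e (Suc n - k)) + a (Suc n) * e 0"
      by simp
    also have "(\<Sum>k=1..n. a k * e (Suc n - k)) = (\<Sum>k=1..n. a k * e (n - k) + a k * f (Suc n - k))"
      by (rule sum.cong) (auto simp: e_def Suc_diff_le algebra_simps)
    finally show ?case using Suc by (simp add: sum.distrib e_def)
  qed simp
  have 3: "(\<Sum>j<n. e j) = (\<Sum>k=1..n. e (n - k))"
    by (rule sum.reindex_bij_witness[of _ "\<lambda>k. n - k" "\<lambda>j. n - j"]) auto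
  have "of_nat n * e n = (\<Sum>j<n. e j) + (\<Sum>m\<le>n. of_nat m * f m)" using 1 by simp
  also have "\<dots> = (\<Sum>k=1..n. (1 + a k) * e (n - k))"
    using 2 3 f by (simp add: distrib_right sum.distrib)
  finally show ?thesis .
qed

text \<open>The recurrence compares coefficients in the equation between \<open>deriv F z\<close>
  and \<open>F z\<close> times the sum of \<open>a k * z ^ (k - 1)\<close> over
  \<open>k \<le> b\<close>.\<close>

lemma exp_polynomial_taylor:
  fixes a :: "nat \<Rightarrow> complex" and b :: nat
  defines "F \<equiv> \<lambda>z. exp (\<Sum>k=1..b. a k * z ^ k / of_nat k)"
  defines "f \<equiv> \<lambda>n. (deriv ^^ n) F 0 / fact n"
  shows "f 0 = 1"
    and "of_nat m * f m = (\<Sum>k=1..m. (if k \<le> b then a k else 0) * f (m - k))"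
    and "(\<lambda>n. f n * z ^ n) sums F z"
proof -
  have holo: "F holomorphic_on S" for S unfolding F_def by (intro holomorphic_intros) auto
  show "f 0 = 1" by (simp add: f_def F_def power_0_left)
  show "(\<lambda>n. f n * z ^ n) sums F z"
    using holomorphic_power_series[OF holo, of z 0 "norm z + 1"] by (simp add: f_def)
  have "\<exists>Fh. F has_fps_expansion Fh"
    using analytic_at_imp_has_fps_expansion_0[of F] holo[of UNIV] analytic_on_open[of UNIV F] analytic_on_subset
    by (meson open_UNIV subset_UNIV)
  then obtain Fh where Fh: "F has_fps_expansion Fh" by blast
  have nth: "fps_nth Fh n = f n" for n using fps_nth_fps_expansion[OF Fh] by (simp add: f_def)
  define D where "D = (\<Sum>k=1..b. fps_const (a k) * fps_X ^ (k - 1))"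
  have D: "(\<lambda>z. \<Sum>k=1..b. a k * z ^ (k - 1)) has_fps_expansion D"
    unfolding D_def by (intro fps_expansion_intros)
  have "(\<lambda>z. (\<Sum>k=1..b. a k * z ^ (k - 1)) * F z) has_fps_expansion D * Fh"
    by (rule has_fps_expansion_mult[OF D Fh])
  moreover have "deriv F z = (\<Sum>k=1..b. a k * z ^ (k - 1)) * F z" for z
  proof (rule DERIV_imp_deriv)
    have "((\<lambda>z. \<Sum>k=1..b. a k * z ^ k / of_nat k) has_field_derivative
        (\<Sum>k=1..b. a k * (of_nat k * z ^ (k - 1)) / of_nat k)) (at z)"
      by (auto intro!: derivative_eq_intros sum.cong)
    also have "(\<Sum>k=1..b. a k * (of_nat k * z ^ (k - 1)) / of_nat k) = (\<Sum>k=1..b. a k * z ^ (k - 1))"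
      by (rule sum.cong) auto
    finally show "(F has_field_derivative (\<Sum>k=1..b. a k * z ^ (k - 1)) * F z) (at z)"
      unfolding F_def by (subst mult.commute) (rule DERIV_fun_exp)
  qed
  ultimately have "deriv F has_fps_expansion D * Fh" by presburger
  then have *: "fps_deriv Fh = D * Fh"
    using fps_expansion_unique_complex has_fps_expansion_deriv[OF Fh] by blast
  have Dn: "fps_nth D i = (if Suc i \<le> b then a (Suc i) else 0)" for i
  proof -
    have "fps_nth D i = (\<Sum>k=1..b. if k = Suc i then a k else 0)"
      unfolding D_def fps_sum_nth by (rule sum.cong) (auto simp: fps_X_power_nth)
    then show ?thesis by simp
  qed
  show "of_nat m * f m = (\<Sum>k=1..m. (if k \<le> b then a k else 0) * f (m - k))"
  proof (cases m)
    case (Suc n)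
    have "of_nat m * f m = fps_nth (fps_deriv Fh) n" using Suc nth by simp
    also have "\<dots> = (\<Sum>i=0..n. (if Suc i \<le> b then a (Suc i) else 0) * f (n - i))"
      unfolding * fps_mult_nth Dn nth ..
    also have "\<dots> = (\<Sum>k=1..m. (if k \<le> b then a k else 0) * f (m - k))"
      by (rule sum.reindex_bij_witness[of _ "\<lambda>k. k - 1" Suc]) (auto simp: Suc)
    finally show ?thesis .
  qed simp
qed

text \<open>The difference is the tail of the Taylor series at 1. Cauchy's inequality bounds the
  coefficients geometrically, and the tail is summed from index \<open>n + 1\<close>.\<close>

lemma exp_polynomial_partial_sum_bound:
  fixes a :: "nat \<Rightarrow> complex" and b n :: nat
  assumes b: "b \<ge> 1"
  defines "F \<equiv> \<lambda>z. exp (\<Sum>k=1..b. a k * z ^ k / of_nat k)"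
  defines "f \<equiv> \<lambda>n. (deriv ^^ n) F 0 / fact n"
  shows "norm ((\<Sum>m\<le>n. f m) - F 1) \<le> b * exp (- real n / b) * exp (3 * (\<Sum>k=1..b. norm (a k) / k))"
proof -
  \<comment> \<open>With this radius \<open>\<rho> ^ k \<le> exp 1 \<le> 3\<close> for all
    \<open>k \<le> b\<close>, which is the 3 in \<open>M\<close>, while
    \<open>\<rho> - 1 \<ge> 1 / b\<close> costs only a factor \<open>b\<close> in the geometric
    tail.\<close>
  define \<rho> where "\<rho> = exp (1 / real b)"
  define M where "M = exp (3 * (\<Sum>k=1..b. norm (a k) / k))"
  have \<rho>: "\<rho> > 1" unfolding \<rho>_def using b by simp
  have \<rho>': "\<rho> - 1 \<ge> 1 / b" unfolding \<rho>_def using exp_ge_add_one_self[of "1 / real b"] by linarith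
  have holo: "F holomorphic_on S" for S unfolding F_def by (intro holomorphic_intros) auto
  have FM: "norm (F z) \<le> M" if z: "norm (0 - z) = \<rho>" for z
  proof -
    have "norm (F z) \<le> exp (norm (\<Sum>k=1..b. a k * z ^ k / of_nat k))"
      unfolding F_def by (rule norm_exp)
    also have "norm (\<Sum>k=1..b. a k * z ^ k / of_nat k) \<le> (\<Sum>k=1..b. norm (a k) * 3 / k)"
    proof (rule order_trans[OF norm_sum], rule sum_mono)
      fix k assume k: "k \<in> {1..b}"
      have "\<rho> ^ k = exp (k / b)" unfolding \<rho>_def by (simp add: exp_of_nat_mult[symmetric])
      also have "\<dots> \<le> exp 1" using k by simp
      also have "\<dots> \<le> 3" by (rule exp_le)
      finally show "norm (a k * z ^ k / of_nat k) \<le> norm (a k) * 3 / k"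
        using z by (auto simp: norm_mult norm_divide norm_power intro!: divide_right_mono mult_left_mono)
    qed
    finally show ?thesis by (simp add: M_def sum_distrib_left mult.commute)
  qed
  have fM: "norm (f m) \<le> M * (1 / \<rho>) ^ m" for m
  proof -
    have "norm ((deriv ^^ m) F 0) \<le> fact m * M / \<rho> ^ m"
      by (rule Cauchy_inequality) (use holo FM \<rho> in \<open>auto intro: holomorphic_on_imp_continuous_on\<close>)
    then have "norm ((deriv ^^ m) F 0) / fact m \<le> fact m * M / \<rho> ^ m / fact m"
      by (rule divide_right_mono) simp
    then show ?thesis by (simp add: f_def norm_divide power_one_over)
  qed
  have s: "f sums F 1" using exp_polynomial_taylor(3)[where z = 1 and a = a and b = b] by (simp add: f_def F_def)
  then have t: "(\<lambda>m. f (m + Suc n)) sums (F 1 - (\<Sum>m<Suc n. f m))" by (rule sums_split_initial_segment)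
  have g: "(\<lambda>m. M * (1 / \<rho>) ^ Suc n * (1 / \<rho>) ^ m) sums (M * (1 / \<rho>) ^ Suc n * (1 / (1 - 1 / \<rho>)))"
    by (intro sums_mult geometric_sums) (use \<rho> in simp)
  have "norm (F 1 - (\<Sum>m<Suc n. f m)) \<le> M * (1 / \<rho>) ^ Suc n * (1 / (1 - 1 / \<rho>))"
  proof (rule norm_sums_le[OF t g])
    fix m show "norm (f (m + Suc n)) \<le> M * (1 / \<rho>) ^ Suc n * (1 / \<rho>) ^ m"
      using fM[of "m + Suc n"] by (simp add: power_add mult_ac)
  qed
  \<comment> \<open>The extra factor \<open>1 / \<rho>\<close> from starting at \<open>Suc n\<close>
    turns \<open>1 - 1 / \<rho>\<close> into \<open>\<rho> - 1\<close>.\<close>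
  also have "M * (1 / \<rho>) ^ Suc n * (1 / (1 - 1 / \<rho>)) = M * (1 / \<rho>) ^ n * (1 / (\<rho> - 1))"
    using \<rho> by (simp add: field_simps)
  also have "\<dots> \<le> M * (1 / \<rho>) ^ n * b"
  proof (rule mult_left_mono)
    show "1 / (\<rho> - 1) \<le> b" using \<rho>' \<rho> b by (simp add: field_simps)
  qed (use \<rho> in \<open>simp add: M_def\<close>)
  also have "(1 / \<rho>) ^ n = exp (- real n / b)"
    unfolding \<rho>_def by (simp add: power_divide exp_of_nat_mult[symmetric] exp_minus field_simps)
  finally show ?thesis by (simp add: M_def norm_minus_commute mult_ac lessThan_Suc_atMost)
qed

subsection \<open>The limit law\<close>

lemma norm_iexp_diff_le: "norm (iexp x - iexp y) \<le> \<bar>x - y\<bar>" for x y :: real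
proof -
  have "iexp x - iexp y = iexp y * (iexp (x - y) - 1)"
    by (simp add: algebra_simps mult_exp_exp)
  then have "norm (iexp x - iexp y) = norm (iexp (x - y) - 1)"
    by (simp add: norm_mult)
  also have "\<dots> \<le> \<bar>x - y\<bar>" using iexp_approx1[of "x - y" 0] by simp
  finally show ?thesis .
qed

text \<open>By the exponential formula the mean is exactly a partial sum of Taylor coefficients of
  \<open>F\<close>, and \<open>F 1\<close> is the characteristic function of a sum of
  \<open>ln k\<close> times independent Poisson variables of mean \<open>1 / k\<close>, for
  \<open>k \<le> b\<close>.\<close>

lemma mean_iexp_truncated_log_cycle_prod:
  fixes \<theta> :: real and b :: nat
  assumes A: "finite A" and b: "b \<ge> 1"
  defines "w \<equiv> \<lambda>k. if k \<le> b then ln (real k) / real k else 0"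
  shows "norm ((\<Sum>p | p permutes A. iexp (\<theta> * (\<Sum>x\<in>A. w (cycle_len p x)))) / fact (card A)
      - exp (\<Sum>k=1..b. (iexp (\<theta> * ln k) - 1) / of_nat k))
    \<le> b * exp (- real (card A) / b) * exp (3 * (\<Sum>k=1..b. \<bar>\<theta>\<bar> * ln k / k))"
proof -
  define n where "n = card A"
  define a where "a k = iexp (\<theta> * ln (real k)) - 1" for k :: nat
  define F where "F z = exp (\<Sum>k=1..b. a k * z ^ k / of_nat k)" for z
  define f where "f m = (deriv ^^ m) F 0 / fact m" for m
  define e where "e m = (\<Sum>j\<le>m. f j)" for m
  \<comment> \<open>Then \<open>v k ^ k\<close> is \<open>iexp (\<theta> * ln k)\<close> for
    \<open>1 \<le> k \<le> b\<close> and 1 for larger \<open>k\<close>, that is, one plus the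
    coefficient in the recurrence for \<open>f\<close>.\<close>
  define v where "v k = iexp (\<theta> * w k)" for k
  have F: "F = (\<lambda>z. exp (\<Sum>k=1..b. a k * z ^ k / of_nat k))" by (simp add: F_def fun_eq_iff)
  have f: "f = (\<lambda>m. (deriv ^^ m) F 0 / fact m)" by (simp add: f_def fun_eq_iff)
  have f0: "f 0 = 1"
    unfolding f F by (rule exp_polynomial_taylor(1))
  have rec: "of_nat m * f m = (\<Sum>k=1..m. (if k \<le> b then a k else 0) * f (m - k))" for m
    unfolding f F by (rule exp_polynomial_taylor(2))
  have bound: "norm (e n - F 1) \<le> b * exp (- real n / b) * exp (3 * (\<Sum>k=1..b. norm (a k) / k))"
    unfolding e_def f F by (rule exp_polynomial_partial_sum_bound[OF b])
  have e: "of_nat m * e m = (\<Sum>k=1..m. v k ^ k * e (m - k))" for m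
  proof -
    have "of_nat m * e m = (\<Sum>k=1..m. (1 + (if k \<le> b then a k else 0)) * e (m - k))"
      unfolding e_def by (rule exp_partial_sum_recurrence[OF rec])
    also have "\<dots> = (\<Sum>k=1..m. v k ^ k * e (m - k))"
      by (rule sum.cong) (auto simp: v_def a_def w_def exp_of_nat_mult[symmetric])
    finally show ?thesis .
  qed
  have "(\<Sum>p | p permutes A. iexp (\<theta> * (\<Sum>x\<in>A. w (cycle_len p x)))) =
      (\<Sum>p | p permutes A. \<Prod>x\<in>A. v (cycle_len p x))"
    using A by (intro sum.cong refl) (simp add: v_def sum_distrib_left exp_sum)
  also have "\<dots> = fact n * e n"
    unfolding n_def by (rule sum_prod_cycle_len[OF A _ e]) (simp add: e_def f0)
  finally have "(\<Sum>p | p permutes A. iexp (\<theta> * (\<Sum>x\<in>A. w (cycle_len p x)))) / fact n = e n"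
    by simp
  moreover have "F 1 = exp (\<Sum>k=1..b. (iexp (\<theta> * ln k) - 1) / of_nat k)"
    by (simp add: F_def a_def)
  moreover have "(\<Sum>k=1..b. norm (a k) / k) \<le> (\<Sum>k=1..b. \<bar>\<theta>\<bar> * ln k / k)"
  proof (rule sum_mono)
    fix k assume k: "k \<in> {1..b}"
    have "norm (a k) \<le> \<bar>\<theta> * ln k\<bar>" using norm_iexp_diff_le[of "\<theta> * ln k" 0] by (simp add: a_def)
    also have "\<dots> = \<bar>\<theta>\<bar> * ln k" using k by (simp add: abs_mult)
    finally show "norm (a k) / k \<le> \<bar>\<theta>\<bar> * ln k / k" by (rule divide_right_mono) simp
  qed
  then have "exp (3 * (\<Sum>k=1..b. norm (a k) / k)) \<le> exp (3 * (\<Sum>k=1..b. \<bar>\<theta>\<bar> * ln k / k))"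
    by simp
  then have "b * exp (- real n / b) * exp (3 * (\<Sum>k=1..b. norm (a k) / k))
      \<le> b * exp (- real n / b) * exp (3 * (\<Sum>k=1..b. \<bar>\<theta>\<bar> * ln k / k))"
    by (rule mult_left_mono) simp
  with bound have "norm (e n - F 1) \<le> b * exp (- real n / b) * exp (3 * (\<Sum>k=1..b. \<bar>\<theta>\<bar> * ln k / k))"
    by (rule order_trans)
  ultimately show ?thesis by (simp only: n_def)
qed

lemma sum_inverse_squares_le: "(\<Sum>k=1..n. 1 / (real k)\<^sup>2) \<le> 2"
proof -
  \<comment> \<open>The sharper bound makes the induction telescope.\<close>
  have "(\<Sum>k=1..n. 1 / (real k)\<^sup>2) \<le> 2 - 1 / n" if "n \<ge> 1"
    using that
  proof (induction n rule: dec_induct)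
    case (step n)
    have "1 / (real (Suc n))\<^sup>2 \<le> 1 / (n * real (Suc n))"
      using step by (intro divide_left_mono) (auto simp: power2_eq_square)
    also have "\<dots> = 1 / n - 1 / Suc n" using step by (simp add: field_simps)
    finally have "1 / (real (Suc n))\<^sup>2 \<le> 1 / n - 1 / Suc n" .
    then show ?case using step by simp
  qed simp
  moreover have "0 \<le> 1 / real n" by simp
  ultimately show ?thesis by (cases "n \<ge> 1") (linarith, simp)
qed

text \<open>The difference is a sum of two nonnegative errors. The excess over
  \<open>log_cycle_prod\<close> has mean at most the sum of inverse squares, hence at most 2; the
  cycles longer than \<open>b\<close> have exactly the mean given by the remaining sum.\<close>

lemma mean_abs_ln_card_involution_splits_diff:
  fixes b :: nat
  assumes A: "finite A"
  defines "w \<equiv> \<lambda>k. if k \<le> b then ln (real k) / real k else 0"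
  shows "(\<Sum>p | p permutes A. \<bar>ln (card (involution_splits A p)) - (\<Sum>x\<in>A. w (cycle_len p x))\<bar>)
      / fact (card A) \<le> 2 + (\<Sum>k\<in>{b<..card A}. ln k / k)"
proof -
  define g where "g k = (if k \<le> b then 0 else ln (real k) / real k)" for k
  define D where "D p = (\<Sum>x\<in>A. 1 / (real (cycle_len p x))\<^sup>2 *
      card {y \<in> A - orbit p x. cycle_len p y = cycle_len p x})" for p :: "'a \<Rightarrow> 'a"
  have "\<bar>ln (card (involution_splits A p)) - (\<Sum>x\<in>A. w (cycle_len p x))\<bar>
      \<le> D p + (\<Sum>x\<in>A. g (cycle_len p x))" if p: "p permutes A" for p
  proof -
    have "log_cycle_prod A p = (\<Sum>x\<in>A. w (cycle_len p x) + g (cycle_len p x))"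
      unfolding log_cycle_prod_def by (rule sum.cong) (auto simp: w_def g_def)
    then have "log_cycle_prod A p = (\<Sum>x\<in>A. w (cycle_len p x)) + (\<Sum>x\<in>A. g (cycle_len p x))"
      by (simp add: sum.distrib)
    moreover have "(\<Sum>x\<in>A. g (cycle_len p x)) \<ge> 0"
      by (rule sum_nonneg) (auto simp: g_def)
    moreover have "ln (card (involution_splits A p)) - log_cycle_prod A p \<le> D p"
      unfolding D_def by (rule ln_card_involution_splits_diff_le[OF A p])
    moreover have "log_cycle_prod A p \<le> ln (card (involution_splits A p))"
      using log_cycle_prod_le[OF A p] by simp
    ultimately show ?thesis by linarith
  qed
  then have "(\<Sum>p | p permutes A. \<bar>ln (card (involution_splits A p)) - (\<Sum>x\<in>A. w (cycle_len p x))\<bar>)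
    \<le> (\<Sum>p | p permutes A. D p + (\<Sum>x\<in>A. g (cycle_len p x)))" by (intro sum_mono) auto
  also have "\<dots> = (\<Sum>p | p permutes A. D p) + fact (card A) * (\<Sum>k=1..card A. g k)"
    unfolding sum.distrib sum_sum_cycle_len[OF A] ..
  also have "(\<Sum>p | p permutes A. D p) \<le> fact (card A) * (\<Sum>k=1..card A. 1 / (real k)\<^sup>2)"
    unfolding D_def by (rule sum_other_cycles_same_len[OF A]) simp
  also have "\<dots> \<le> fact (card A) * 2"
    by (rule mult_left_mono[OF sum_inverse_squares_le]) simp
  also have "(\<Sum>k=1..card A. g k) = (\<Sum>k\<in>{b<..card A}. ln k / k)"
    by (rule sum.mono_neutral_cong_right) (auto simp: g_def not_le Suc_le_eq)
  finally show ?thesis by (simp add: divide_le_eq distrib_left mult.commute)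
qed

section \<open>Logarithmic sums and the expansion of the exponent\<close>

lemma inverse_le_ln_diff: "1 / real (Suc k) \<le> ln (Suc k) - ln k" if "k \<ge> 1"
proof -
  have "- ln (real (Suc k) / k) = ln (k / Suc k)" using that by (simp add: ln_div)
  also have "\<dots> \<le> k / Suc k - 1" by (rule ln_le_minus_one) (use that in simp)
  also have "\<dots> = - (1 / Suc k)" by (simp add: field_simps)
  finally show ?thesis using that by (simp add: ln_div)
qed

lemma sum_inverse_le_ln_diff:
  assumes "1 \<le> b" "b \<le> n"
  shows "(\<Sum>k\<in>{b<..n}. 1 / real k) \<le> ln n - ln b"
  using assms(2)
proof (induction n rule: dec_induct)
  case (step n)
  have "{b<..Suc n} = insert (Suc n) {b<..n}" using step by auto
  then show ?case using step inverse_le_ln_diff[of n] assms by simp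
qed simp

lemma sum_ln_power_div_le:
  assumes "1 \<le> b" "b \<le> n"
  shows "(\<Sum>k\<in>{b<..n}. ln (real k) ^ j / k) \<le> ln n ^ j * (ln n - ln b)"
proof -
  have "(\<Sum>k\<in>{b<..n}. ln (real k) ^ j / k) \<le> (\<Sum>k\<in>{b<..n}. ln n ^ j * (1 / k))"
    by (rule sum_mono) (use assms in \<open>auto intro!: divide_right_mono power_mono\<close>)
  also have "\<dots> = ln n ^ j * (\<Sum>k\<in>{b<..n}. 1 / k)" by (simp only: sum_distrib_left)
  also have "\<dots> \<le> ln n ^ j * (ln n - ln b)"
    by (rule mult_left_mono[OF sum_inverse_le_ln_diff[OF assms]]) (use assms in auto)
  finally show ?thesis .
qed

text \<open>The term for \<open>k = 1\<close> vanishes because \<open>j \<ge> 1\<close>, so the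
  cutoff 1 can be used in the previous bound.\<close>

lemma sum_ln_power_div_le':
  assumes "1 \<le> n" "j \<ge> 1"
  shows "(\<Sum>k=1..n. ln (real k) ^ j / k) \<le> ln n ^ j * ln n"
proof -
  have "{1..n} = insert 1 {1<..n}" using assms by auto
  then show ?thesis using sum_ln_power_div_le[of 1 n j] assms by (simp add: zero_power)
qed

lemma sigma_seq_square: "(sigma_seq n)\<^sup>2 = (\<Sum>k=1..n. ln (real k) ^ 2 / k)"
  unfolding sigma_seq_def by (rule real_sqrt_pow2) (auto intro!: sum_nonneg)

text \<open>The increments of \<open>ln n ^ 3\<close> are compared with the summands. The constant 6
  is 3, from the factorisation of a difference of cubes, times 2, from
  \<open>1 / n \<le> 2 / Suc n\<close>; only the order of magnitude matters later.\<close>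

lemma sigma_seq_ge:
  assumes "n \<ge> 1"
  shows "sqrt (ln n ^ 3 / 6) \<le> sigma_seq n"
proof -
  have "ln (real n) ^ 3 \<le> 6 * (\<Sum>k=1..n. ln (real k) ^ 2 / k)"
    using assms
  proof (induction n rule: dec_induct)
    case (step n)
    define x y where "x = ln (real n)" and "y = ln (real (Suc n))"
    have xy: "0 \<le> x" "x \<le> y" using step by (auto simp: x_def y_def)
    have "y - x = ln (Suc n / n)" using step by (simp add: x_def y_def ln_div)
    also have "\<dots> \<le> Suc n / n - 1" by (rule ln_le_minus_one) (use step in simp)
    also have "\<dots> \<le> 2 / Suc n" using step by (simp add: field_simps)
    finally have d: "y - x \<le> 2 / Suc n" .
    have "y ^ 3 - x ^ 3 = (y - x) * (y\<^sup>2 + x * y + x\<^sup>2)" by (simp add: power2_eq_square power3_eq_cube algebra_simps)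
    also have "\<dots> \<le> (2 / Suc n) * (3 * y\<^sup>2)"
    proof (rule mult_mono[OF d])
      have "x * y \<le> y * y" "x * x \<le> y * y" using xy by (auto intro!: mult_mono)
      then show "y\<^sup>2 + x * y + x\<^sup>2 \<le> 3 * y\<^sup>2" by (simp add: power2_eq_square)
    qed (use xy in auto)
    finally have "y ^ 3 \<le> x ^ 3 + 6 * (y ^ 2 / Suc n)" by simp
    then show ?case using step.IH by (simp add: x_def y_def)
  qed simp
  then have "ln n ^ 3 / 6 \<le> (sigma_seq n)\<^sup>2" by (simp add: sigma_seq_square)
  moreover have "0 \<le> sigma_seq n" unfolding sigma_seq_def by (auto intro!: sum_nonneg)
  ultimately show ?thesis by (rule real_le_lsqrt[rotated])
qed

text \<open>Second-order expansion of each \<open>iexp (\<theta> * ln k)\<close>. The first error is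
  the Taylor remainder; the other two come from extending the linear and quadratic sums from
  \<open>b\<close> to \<open>n\<close>, where they become \<open>mu_seq\<close> and the square of
  \<open>sigma_seq\<close>.\<close>

lemma exponent_approx:
  fixes t :: real
  assumes b: "1 \<le> b" "b \<le> n" and \<sigma>: "sigma_seq n > 0"
  defines "\<theta> \<equiv> t / sigma_seq n"
  shows "norm ((\<Sum>k=1..b. (iexp (\<theta> * ln k) - 1) / of_nat k) - \<i> * (\<theta> * mu_seq n) + t\<^sup>2 / 2)
    \<le> \<bar>\<theta>\<bar> ^ 3 * (ln n ^ 3 * ln n) + \<bar>\<theta>\<bar> * (ln n * (ln n - ln b)) + \<theta>\<^sup>2 / 2 * (ln n ^ 2 * (ln n - ln b))"
proof -
  have un: "{1..n} = {1..b} \<union> {b<..n}" using b by auto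
  have \<mu>: "mu_seq n = (\<Sum>k=1..b. ln (real k) / k) + (\<Sum>k\<in>{b<..n}. ln (real k) / k)"
    unfolding mu_seq_def un by (rule sum.union_disjoint) auto
  have \<sigma>2: "(sigma_seq n)\<^sup>2 = (\<Sum>k=1..b. ln (real k) ^ 2 / k) + (\<Sum>k\<in>{b<..n}. ln (real k) ^ 2 / k)"
    unfolding sigma_seq_square un by (rule sum.union_disjoint) auto
  define X where "X = (\<Sum>k\<in>{b<..n}. ln (real k) / k)"
  define Y where "Y = (\<Sum>k\<in>{b<..n}. ln (real k) ^ 2 / k)"
  define U where "U = (\<Sum>k=1..b. ln (real k) / k)"
  define V where "V = (\<Sum>k=1..b. ln (real k) ^ 2 / k)"
  define Z where "Z = (\<Sum>k=1..b. (iexp (\<theta> * ln k) - 1 - \<i> * (\<theta> * ln k) + (\<theta> * ln k)\<^sup>2 / 2) / of_nat k)"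
  have X: "0 \<le> X" "X \<le> ln n * (ln n - ln b)"
    using sum_ln_power_div_le[OF b, of 1] unfolding X_def by (auto intro!: sum_nonneg)
  have Y: "0 \<le> Y" "Y \<le> ln n ^ 2 * (ln n - ln b)"
    using sum_ln_power_div_le[OF b, of 2] unfolding Y_def by (auto intro!: sum_nonneg)
  have Z: "norm Z \<le> \<bar>\<theta>\<bar> ^ 3 * (ln n ^ 3 * ln n)"
  proof -
    have "norm Z \<le> (\<Sum>k=1..b. \<bar>\<theta>\<bar> ^ 3 * (ln (real k) ^ 3 / k))"
      unfolding Z_def
    proof (rule order_trans[OF norm_sum], rule sum_mono)
      fix k assume k: "k \<in> {1..b}"
      define y where "y = \<theta> * ln (real k)"
      have "iexp y - (\<Sum>j\<le>2. (\<i> * y) ^ j / fact j) = iexp y - 1 - \<i> * y + y\<^sup>2 / 2"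
        by (simp add: numeral_2_eq_2 power_mult_distrib algebra_simps)
      then have "norm (iexp y - 1 - \<i> * y + y\<^sup>2 / 2) \<le> \<bar>y\<bar> ^ Suc 2 / fact (Suc 2)"
        using iexp_approx1[of y 2] by (simp only:)
      also have "\<dots> = \<bar>y\<bar> ^ 3 / fact 3" by (simp only: eval_nat_numeral)
      also have "\<dots> \<le> \<bar>y\<bar> ^ 3 / 1"
        by (rule divide_left_mono) (auto simp: fact_numeral)
      also have "\<dots> = \<bar>\<theta>\<bar> ^ 3 * ln (real k) ^ 3"
        using k by (simp add: y_def abs_mult power_mult_distrib)
      finally have "norm (iexp y - 1 - \<i> * y + y\<^sup>2 / 2) / k \<le> \<bar>\<theta>\<bar> ^ 3 * ln (real k) ^ 3 / k"
        by (rule divide_right_mono) simp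
      then show "norm ((iexp (\<theta> * ln k) - 1 - \<i> * (\<theta> * ln k) + (\<theta> * ln k)\<^sup>2 / 2) / of_nat k)
          \<le> \<bar>\<theta>\<bar> ^ 3 * (ln (real k) ^ 3 / k)"
        by (simp add: norm_divide y_def)
    qed
    also have "\<dots> = \<bar>\<theta>\<bar> ^ 3 * (\<Sum>k=1..b. ln (real k) ^ 3 / k)" by (simp only: sum_distrib_left)
    also have "\<dots> \<le> \<bar>\<theta>\<bar> ^ 3 * (ln b ^ 3 * ln b)"
      by (rule mult_left_mono[OF sum_ln_power_div_le']) (use b in auto)
    also have "\<dots> \<le> \<bar>\<theta>\<bar> ^ 3 * (ln n ^ 3 * ln n)"
      using b by (intro mult_left_mono mult_mono power_mono) auto
    finally show ?thesis .
  qed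
  \<comment> \<open>The normalisation by \<open>sigma_seq\<close> is what turns the quadratic term
    into \<open>t\<^sup>2 / 2\<close>.\<close>
  have t: "t\<^sup>2 = \<theta>\<^sup>2 * (sigma_seq n)\<^sup>2" using \<sigma> by (simp add: \<theta>_def power_divide)
  have "Z = (\<Sum>k=1..b. (iexp (\<theta> * ln k) - 1) / of_nat k) - \<i> * \<theta> * of_real U
      + \<theta>\<^sup>2 / 2 * of_real V"
    unfolding Z_def U_def V_def of_real_sum sum_distrib_left sum_subtractf[symmetric] sum.distrib[symmetric]
    by (rule sum.cong) (auto simp: field_simps power2_eq_square)
  then have "(\<Sum>k=1..b. (iexp (\<theta> * ln k) - 1) / of_nat k) - \<i> * (\<theta> * mu_seq n) + t\<^sup>2 / 2
      = Z - \<i> * (\<theta> * X) + of_real (\<theta>\<^sup>2 / 2 * Y)"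
    unfolding t \<mu> \<sigma>2 X_def[symmetric] Y_def[symmetric] U_def[symmetric] V_def[symmetric]
    by (simp add: algebra_simps add_divide_distrib)
  also have "norm \<dots> \<le> norm Z + norm (\<i> * (\<theta> * X)) + norm (complex_of_real (\<theta>\<^sup>2 / 2 * Y))"
    by (rule order_trans[OF norm_triangle_ineq add_right_mono[OF norm_triangle_ineq4]])
  also have "\<dots> = norm Z + \<bar>\<theta>\<bar> * X + \<theta>\<^sup>2 / 2 * Y"
    using X Y by (simp add: norm_mult norm_power abs_mult)
  also have "\<dots> \<le> \<bar>\<theta>\<bar> ^ 3 * (ln n ^ 3 * ln n) + \<bar>\<theta>\<bar> * (ln n * (ln n - ln b)) + \<theta>\<^sup>2 / 2 * (ln n ^ 2 * (ln n - ln b))"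
    by (intro add_mono mult_left_mono Z X Y) auto
  finally show ?thesis .
qed

section \<open>The normal law and the uniform measure\<close>

lemma cdf_std_normal_distribution: "cdf std_normal_distribution x = Phi x"
proof -
  interpret real_distribution std_normal_distribution by (rule real_dist_normal_dist)
  have "cdf std_normal_distribution x = (LINT t|std_normal_distribution. indicator {..x} t)"
    by (simp add: cdf_def)
  also have "\<dots> = (LINT t|lborel. std_normal_density t *\<^sub>R indicator {..x} t)"
    by (subst integral_density) auto
  also have "\<dots> = (LINT t|lborel. 1 / sqrt (2 * pi) * (indicator {..x} t * exp (- t\<^sup>2 / 2)))"
    by (rule Bochner_Integration.integral_cong) (auto simp: std_normal_density_def)
  also have "\<dots> = Phi x"
    by (simp add: Phi_def set_lebesgue_integral_def)
  finally show ?thesis .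
qed

text \<open>A law with a density has no atoms; hence weak convergence gives convergence of the
  distribution functions at every \<open>x\<close>.\<close>

lemma isCont_cdf_std_normal_distribution: "isCont (cdf std_normal_distribution) x"
proof -
  interpret real_distribution std_normal_distribution by (rule real_dist_normal_dist)
  have "AE y in lborel. y \<noteq> x" by (rule AE_lborel_singleton)
  then have "AE y in std_normal_distribution. y \<notin> {x}"
    by (subst AE_density) auto
  then have "emeasure std_normal_distribution {x} = 0"
    by (subst (asm) AE_iff_measurable[of "{x}"]) auto
  then show ?thesis by (simp add: isCont_cdf measure_def)
qed

lemma finite_Sym: "finite (Sym n)" "Sym n \<noteq> {}" "card (Sym n) = fact n"
  unfolding Sym_def using finite_permutations[of "{1..n}"] card_permutations[of "{1..n}" n]
  by (auto intro: permutes_id)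

lemma integral_P_unif:
  fixes f :: "(nat \<Rightarrow> nat) \<Rightarrow> 'b::{banach, second_countable_topology, real_normed_field}"
  shows "(LINT \<pi>|measure_pmf (P_unif n). f \<pi>) = (\<Sum>\<pi> | \<pi> permutes {1..n}. f \<pi>) / fact n"
proof -
  have "(LINT \<pi>|measure_pmf (P_unif n). f \<pi>) = (\<Sum>\<pi>\<in>Sym n. pmf (P_unif n) \<pi> *\<^sub>R f \<pi>)"
    by (rule integral_measure_pmf) (use finite_Sym in \<open>auto simp: P_unif_def\<close>)
  also have "\<dots> = (\<Sum>\<pi>\<in>Sym n. f \<pi> / fact n)"
    by (rule sum.cong) (use finite_Sym in \<open>auto simp: P_unif_def scaleR_conv_of_real\<close>)
  finally show ?thesis by (simp add: Sym_def sum_divide_distrib)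
qed

section \<open>Convergence of the characteristic functions\<close>

text \<open>Two replacements: \<open>ln (N_inv n \<pi>)\<close> by its truncation, at a cost of
  \<open>\<bar>\<theta>\<bar>\<close> times the mean error because \<open>iexp\<close> is
  1-Lipschitz, and then the mean of the truncation by the Poisson expression, at the cost of the
  Taylor tail.\<close>

lemma char_normalised_approx:
  fixes t :: real and b n :: nat
  assumes b: "1 \<le> b" "b \<le> n"
  defines "\<theta> \<equiv> t / sigma_seq n"
  defines "X \<equiv> \<lambda>\<pi>. (ln (N_inv n \<pi>) - mu_seq n) / sigma_seq n"
  shows "norm (char (distr (measure_pmf (P_unif n)) borel X) t
      - exp ((\<Sum>k=1..b. (iexp (\<theta> * ln k) - 1) / of_nat k) - \<i> * (\<theta> * mu_seq n)))
    \<le> \<bar>\<theta>\<bar> * (2 + ln n * (ln n - ln b)) + b * exp (- real n / b) * exp (3 * (\<bar>\<theta>\<bar> * (ln n * ln n)))"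
proof -
  define A where "A = {1..n}"
  have A: "finite A" "card A = n" by (simp_all add: A_def)
  define L where "L \<pi> = ln (real (card (involution_splits A \<pi>)))" for \<pi>
  define T where "T \<pi> = (\<Sum>x\<in>A. if cycle_len \<pi> x \<le> b then ln (real (cycle_len \<pi> x)) / cycle_len \<pi> x else 0)" for \<pi>
  define S where "S = (\<Sum>k=1..b. (iexp (\<theta> * ln k) - 1) / of_nat k)"
  \<comment> \<open>Centring only multiplies by a number of modulus 1.\<close>
  define c where "c = iexp (- (\<theta> * mu_seq n))"
  define EL where "EL = (\<Sum>\<pi> | \<pi> permutes A. iexp (\<theta> * L \<pi>)) / fact n"
  define ET where "ET = (\<Sum>\<pi> | \<pi> permutes A. iexp (\<theta> * T \<pi>)) / fact n"
  have c: "norm c = 1" by (simp add: c_def)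
  have "char (distr (measure_pmf (P_unif n)) borel X) t = (LINT \<pi>|measure_pmf (P_unif n). iexp (t * X \<pi>))"
    by (simp add: char_def integral_distr)
  also have "\<dots> = (\<Sum>\<pi> | \<pi> permutes A. iexp (t * X \<pi>)) / fact n"
    unfolding A_def by (rule integral_P_unif)
  also have "(\<Sum>\<pi> | \<pi> permutes A. iexp (t * X \<pi>)) = (\<Sum>\<pi> | \<pi> permutes A. c * iexp (\<theta> * L \<pi>))"
  proof (rule sum.cong[OF refl])
    fix \<pi> assume "\<pi> \<in> {\<pi>. \<pi> permutes A}"
    then have "t * X \<pi> = - (\<theta> * mu_seq n) + \<theta> * L \<pi>"
      using N_inv_eq_card_involution_splits[of \<pi> n]
      by (simp add: X_def L_def A_def \<theta>_def diff_divide_distrib algebra_simps)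
    then show "iexp (t * X \<pi>) = c * iexp (\<theta> * L \<pi>)"
      by (simp only: c_def of_real_add distrib_left exp_add)
  qed
  also have "\<dots> / fact n = c * EL" by (simp add: EL_def sum_distrib_left)
  finally have char: "char (distr (measure_pmf (P_unif n)) borel X) t = c * EL" .
  have exp: "exp (S - \<i> * (\<theta> * mu_seq n)) = c * exp S"
    unfolding c_def mult_exp_exp by (simp add: algebra_simps)
  have 1: "norm (EL - ET) \<le> \<bar>\<theta>\<bar> * (2 + ln n * (ln n - ln b))"
  proof -
    have "norm (EL - ET) = norm (\<Sum>\<pi> | \<pi> permutes A. iexp (\<theta> * L \<pi>) - iexp (\<theta> * T \<pi>)) / fact n"
      by (simp add: EL_def ET_def sum_subtractf diff_divide_distrib[symmetric] norm_divide)
    also have "\<dots> \<le> (\<Sum>\<pi> | \<pi> permutes A. \<bar>\<theta>\<bar> * \<bar>L \<pi> - T \<pi>\<bar>) / fact n"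
    proof (rule divide_right_mono, rule order_trans[OF norm_sum], rule sum_mono)
      fix \<pi>
      have "norm (iexp (\<theta> * L \<pi>) - iexp (\<theta> * T \<pi>)) \<le> \<bar>\<theta> * L \<pi> - \<theta> * T \<pi>\<bar>" by (rule norm_iexp_diff_le)
      then show "norm (iexp (\<theta> * L \<pi>) - iexp (\<theta> * T \<pi>)) \<le> \<bar>\<theta>\<bar> * \<bar>L \<pi> - T \<pi>\<bar>"
        by (simp only: right_diff_distrib[symmetric] abs_mult)
    qed simp
    also have "\<dots> = \<bar>\<theta>\<bar> * ((\<Sum>\<pi> | \<pi> permutes A. \<bar>L \<pi> - T \<pi>\<bar>) / fact n)"
      by (simp add: sum_distrib_left)
    also have "\<dots> \<le> \<bar>\<theta>\<bar> * (2 + (\<Sum>k\<in>{b<..n}. ln k / k))"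
      by (rule mult_left_mono)
        (use mean_abs_ln_card_involution_splits_diff[OF A(1), of b] in \<open>simp_all add: A(2) L_def T_def\<close>)
    also have "\<dots> \<le> \<bar>\<theta>\<bar> * (2 + ln n * (ln n - ln b))"
      using sum_ln_power_div_le[OF b, of 1] by (intro mult_left_mono) simp_all
    finally show ?thesis .
  qed
  have 2: "norm (ET - exp S) \<le> b * exp (- real n / b) * exp (3 * (\<bar>\<theta>\<bar> * (ln n * ln n)))"
  proof -
    have "norm (ET - exp S) \<le> b * exp (- real n / b) * exp (3 * (\<Sum>k=1..b. \<bar>\<theta>\<bar> * ln k / k))"
      using mean_iexp_truncated_log_cycle_prod[OF A(1) b(1), of \<theta>] unfolding A(2) ET_def S_def T_def .
    also have "(\<Sum>k=1..b. \<bar>\<theta>\<bar> * ln k / k) = \<bar>\<theta>\<bar> * (\<Sum>k=1..b. ln (real k) ^ 1 / k)"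
      by (simp add: sum_distrib_left)
    also have "b * exp (- real n / b) * exp (3 * (\<bar>\<theta>\<bar> * (\<Sum>k=1..b. ln (real k) ^ 1 / k)))
      \<le> b * exp (- real n / b) * exp (3 * (\<bar>\<theta>\<bar> * (ln n * ln n)))"
    proof (rule mult_left_mono)
      have "(\<Sum>k=1..b. ln (real k) ^ 1 / k) \<le> ln b ^ 1 * ln b" by (rule sum_ln_power_div_le') (use b in auto)
      also have "\<dots> \<le> ln n * ln n" using b by (auto intro!: mult_mono)
      finally have "\<bar>\<theta>\<bar> * (\<Sum>k=1..b. ln (real k) ^ 1 / k) \<le> \<bar>\<theta>\<bar> * (ln n * ln n)"
        by (rule mult_left_mono) simp
      then show "exp (3 * (\<bar>\<theta>\<bar> * (\<Sum>k=1..b. ln (real k) ^ 1 / k))) \<le> exp (3 * (\<bar>\<theta>\<bar> * (ln n * ln n)))"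
        by simp
    qed simp
    finally show ?thesis .
  qed
  have "norm (c * EL - c * exp S) = norm (EL - exp S)"
    by (simp only: right_diff_distrib[symmetric] norm_mult c mult_1)
  also have "\<dots> \<le> norm (EL - ET) + norm (ET - exp S)" by norm
  finally show ?thesis using 1 2 unfolding char S_def[symmetric] exp by linarith
qed

text \<open>The cutoff meets two demands. From \<open>n / b \<ge> ln\<^sup>2 n\<close> the Taylor
  tail beats \<open>n\<close> and an exponential of order \<open>sqrt (ln n)\<close>; and
  \<open>ln n - ln b\<close> is only of order \<open>ln (ln n)\<close>, so long cycles are
  negligible against \<open>sigma_seq n\<close>.\<close>

lemma char_normalised_tendsto:
  fixes t :: real
  defines "X \<equiv> \<lambda>n \<pi>. (ln (N_inv n \<pi>) - mu_seq n) / sigma_seq n"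
  shows "(\<lambda>n. char (distr (measure_pmf (P_unif n)) borel (X n)) t) \<longlonglongrightarrow> of_real (exp (- t\<^sup>2 / 2))"
proof -
  define l where "l n = ln (real n)" for n :: nat
  define b where "b n = nat \<lfloor>real n / (l n)\<^sup>2\<rfloor>" for n
  define \<theta> where "\<theta> n = t / sigma_seq n" for n
  define u where "u n = (\<bar>t\<bar> + 1) / sqrt (l n ^ 3 / 6)" for n \<comment> \<open>\<open>+ 1\<close> keeps the constant positive at \<open>t = 0\<close>\<close>
  \<comment> \<open>An upper bound for \<open>ln n - ln (b n)\<close>; the summand
    \<open>ln 2\<close> pays for the rounding in \<open>b\<close>.\<close>
  define \<delta> where "\<delta> n = ln 2 + 2 * ln (l n)" for n
  define Q where "Q n = (\<Sum>k=1..b n. (iexp (\<theta> n * ln k) - 1) / of_nat k) - \<i> * (\<theta> n * mu_seq n)" for n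
  have ev: "eventually (\<lambda>n. 1 \<le> b n \<and> b n \<le> n \<and> l n - ln (b n) \<le> \<delta> n \<and> (l n)\<^sup>2 \<le> n / b n
      \<and> l n > 0 \<and> sigma_seq n > 0 \<and> \<bar>\<theta> n\<bar> \<le> u n) sequentially"
  proof -
    have "eventually (\<lambda>n::nat. 1 \<le> ln (real n)) sequentially" by real_asymp
    moreover have "eventually (\<lambda>n::nat. 2 \<le> real n / (ln (real n))\<^sup>2) sequentially" by real_asymp
    ultimately show ?thesis
    proof eventually_elim
      case (elim n)
      define r where "r = real n / (l n)\<^sup>2"
      have l1: "1 \<le> l n" and r2: "2 \<le> r" using elim by (simp_all add: l_def r_def)
      have n0: "n \<ge> 1" using l1 by (cases n) (simp_all add: l_def)
      have l2: "1 \<le> (l n)\<^sup>2" using l1 by simp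
      \<comment> \<open>Rounding loses at most 1, and \<open>r \<ge> 2\<close> makes that at most
        half of \<open>r\<close>.\<close>
      have br: "real (b n) \<le> r" "r - 1 \<le> b n" using r2 unfolding b_def r_def[symmetric] by linarith+
      then have b: "1 \<le> b n" "r / 2 \<le> b n" using r2 by linarith+
      have "r \<le> n" unfolding r_def using l2 by (simp add: divide_le_eq mult_le_cancel_left1)
      then have bn: "b n \<le> n" using br by linarith
      have "l n - ln (b n) \<le> l n - ln (r / 2)"
        using b r2 by (intro diff_left_mono ln_mono) auto
      also have "\<dots> = \<delta> n"
      proof -
        have "ln (r / 2) = ln (real n) - 2 * ln (l n) - ln 2"
          using l1 n0 unfolding r_def by (simp add: ln_div ln_mult ln_realpow)
        then show ?thesis unfolding \<delta>_def by (simp add: l_def)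
      qed
      finally have 1: "l n - ln (b n) \<le> \<delta> n" .
      have 2: "(l n)\<^sup>2 \<le> n / b n"
      proof -
        have "0 < (l n)\<^sup>2" using l2 by linarith
        from pos_le_divide_eq[OF this] have "b n * (l n)\<^sup>2 \<le> n" using br(1) unfolding r_def by blast
        then show ?thesis using b(1) by (simp add: pos_le_divide_eq mult.commute)
      qed
      have s: "sqrt (l n ^ 3 / 6) \<le> sigma_seq n" unfolding l_def by (rule sigma_seq_ge[OF n0])
      have s0: "0 < sqrt (l n ^ 3 / 6)" using l1 by simp
      have 3: "sigma_seq n > 0" using s s0 by linarith
      have "\<bar>\<theta> n\<bar> = \<bar>t\<bar> / sigma_seq n" using 3 by (simp add: \<theta>_def)
      also have "\<dots> \<le> u n" unfolding u_def using s s0 3 by (intro frac_le) auto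
      finally show ?case using b(1) bn 1 2 3 l1 by simp
    qed
  qed
  have "(\<lambda>n. char (distr (measure_pmf (P_unif n)) borel (X n)) t - exp (Q n)) \<longlonglongrightarrow> 0"
  proof (rule Lim_null_comparison)
    show "eventually (\<lambda>n. norm (char (distr (measure_pmf (P_unif n)) borel (X n)) t - exp (Q n))
      \<le> u n * (2 + l n * \<delta> n) + n * exp (- (l n)\<^sup>2) * exp (3 * (u n * (l n * l n)))) sequentially"
      using ev
    proof eventually_elim
      case (elim n)
      have d0: "0 \<le> l n - ln (b n)" using elim by (simp add: l_def)
      have u0: "0 \<le> u n" using elim by linarith
      have "norm (char (distr (measure_pmf (P_unif n)) borel (X n)) t - exp (Q n))
        \<le> \<bar>\<theta> n\<bar> * (2 + l n * (l n - ln (b n))) + b n * exp (- real n / b n) * exp (3 * (\<bar>\<theta> n\<bar> * (l n * l n)))"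
        using char_normalised_approx[of "b n" n t] elim unfolding X_def Q_def \<theta>_def l_def by blast
      also have "\<dots> \<le> u n * (2 + l n * \<delta> n) + n * exp (- (l n)\<^sup>2) * exp (3 * (u n * (l n * l n)))"
      proof (intro add_mono mult_mono)
        show "exp (- real n / real (b n)) \<le> exp (- (l n)\<^sup>2)" using elim by simp
        have "\<bar>\<theta> n\<bar> * (l n * l n) \<le> u n * (l n * l n)" using elim by (intro mult_right_mono) auto
        then show "exp (3 * (\<bar>\<theta> n\<bar> * (l n * l n))) \<le> exp (3 * (u n * (l n * l n)))" by simp
      qed (use elim d0 u0 in auto)
      finally show ?case .
    qed
    \<comment> \<open>The first term is of order \<open>ln (ln n) / sqrt (ln n)\<close>; in the
      second, \<open>exp (- (ln n)\<^sup>2)\<close> dominates.\<close>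
    have "(\<lambda>n::nat. c / sqrt (ln n ^ 3 / 6) * (2 + ln n * (ln 2 + 2 * ln (ln n)))
        + n * exp (- (ln n)\<^sup>2) * exp (3 * (c / sqrt (ln n ^ 3 / 6) * (ln n * ln n)))) \<longlonglongrightarrow> 0"
      if "c > 0" for c :: real
      using that by real_asymp
    from this[of "\<bar>t\<bar> + 1"] show "(\<lambda>n. u n * (2 + l n * \<delta> n) + n * exp (- (l n)\<^sup>2) * exp (3 * (u n * (l n * l n)))) \<longlonglongrightarrow> 0"
      unfolding u_def l_def \<delta>_def by simp
  qed
  moreover have "(\<lambda>n. exp (Q n)) \<longlonglongrightarrow> exp (of_real (- t\<^sup>2 / 2))"
  proof (rule tendsto_exp)
    have "(\<lambda>n. Q n - of_real (- t\<^sup>2 / 2)) \<longlonglongrightarrow> 0"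
    proof (rule Lim_null_comparison)
      show "eventually (\<lambda>n. norm (Q n - of_real (- t\<^sup>2 / 2))
        \<le> u n ^ 3 * (l n ^ 3 * l n) + u n * (l n * \<delta> n) + (u n)\<^sup>2 / 2 * (l n ^ 2 * \<delta> n)) sequentially"
        using ev
      proof eventually_elim
        case (elim n)
        have d0: "0 \<le> l n - ln (b n)" using elim by (simp add: l_def)
        have u0: "0 \<le> u n" using elim by linarith
        have sq: "(\<theta> n)\<^sup>2 \<le> (u n)\<^sup>2" using elim by (metis abs_ge_zero power2_abs power_mono)
        have "norm (Q n - of_real (- t\<^sup>2 / 2))
          \<le> \<bar>\<theta> n\<bar> ^ 3 * (l n ^ 3 * l n) + \<bar>\<theta> n\<bar> * (l n * (l n - ln (b n)))
            + (\<theta> n)\<^sup>2 / 2 * (l n ^ 2 * (l n - ln (b n)))"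
          using exponent_approx[of "b n" n t] elim unfolding Q_def \<theta>_def l_def by simp
        also have "\<dots> \<le> u n ^ 3 * (l n ^ 3 * l n) + u n * (l n * \<delta> n) + (u n)\<^sup>2 / 2 * (l n ^ 2 * \<delta> n)"
          by (intro add_mono mult_mono power_mono divide_right_mono sq) (use elim d0 u0 in auto)
        finally show ?case .
      qed
      \<comment> \<open>The orders are \<open>1 / sqrt (ln n)\<close>,
        \<open>ln (ln n) / sqrt (ln n)\<close> and \<open>ln (ln n) / ln n\<close>.\<close>
      have "(\<lambda>n::nat. (c / sqrt (ln n ^ 3 / 6)) ^ 3 * (ln n ^ 3 * ln n)
          + c / sqrt (ln n ^ 3 / 6) * (ln n * (ln 2 + 2 * ln (ln n)))
          + (c / sqrt (ln n ^ 3 / 6))\<^sup>2 / 2 * (ln n ^ 2 * (ln 2 + 2 * ln (ln n)))) \<longlonglongrightarrow> 0"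
        if "c > 0" for c :: real
        using that by real_asymp
      from this[of "\<bar>t\<bar> + 1"] show "(\<lambda>n. u n ^ 3 * (l n ^ 3 * l n) + u n * (l n * \<delta> n) + (u n)\<^sup>2 / 2 * (l n ^ 2 * \<delta> n)) \<longlonglongrightarrow> 0"
        unfolding u_def l_def \<delta>_def by simp
    qed
    then show "Q \<longlonglongrightarrow> of_real (- t\<^sup>2 / 2)" by (rule LIM_zero_cancel)
  qed
  ultimately have "(\<lambda>n. char (distr (measure_pmf (P_unif n)) borel (X n)) t) \<longlonglongrightarrow> exp (of_real (- t\<^sup>2 / 2))"
    by (rule Lim_transform[rotated])
  then show ?thesis by (simp only: exp_of_real)
qed

theorem theorem4p3:
  fixes x :: real
  shows "(\<lambda>n. measure_pmf.prob (P_unif n)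
                {\<pi>. ln (real (N_inv n \<pi>)) \<le> mu_seq n + x * sigma_seq n}) \<longlonglongrightarrow> Phi x"
proof -
  define X where "X n \<pi> = (ln (N_inv n \<pi>) - mu_seq n) / sigma_seq n" for n \<pi>
  define M where "M n = distr (measure_pmf (P_unif n)) borel (X n)" for n
  have "weak_conv_m M std_normal_distribution"
  proof (rule levy_continuity)
    show "real_distribution (M n)" for n
      unfolding M_def by (rule prob_space.real_distribution_distr) (auto intro: prob_space_measure_pmf)
    show "(\<lambda>n. char (M n) t) \<longlonglongrightarrow> char std_normal_distribution t" for t
    proof -
      have X: "X n = (\<lambda>\<pi>. (ln (N_inv n \<pi>) - mu_seq n) / sigma_seq n)" for n
        by (simp add: X_def fun_eq_iff)
      show ?thesis
        using char_normalised_tendsto[of t] unfolding M_def X char_std_normal_distribution .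
    qed
  qed (rule real_dist_normal_dist)
  then have "(\<lambda>n. cdf (M n) x) \<longlonglongrightarrow> Phi x"
    using isCont_cdf_std_normal_distribution
    by (simp add: weak_conv_m_def weak_conv_def cdf_std_normal_distribution)
  \<comment> \<open>For \<open>n \<ge> 2\<close> the number \<open>sigma_seq n\<close> is positive
    and the quotient can be cleared; for \<open>n \<le> 1\<close> it is 0 and \<open>X n\<close> is
    a division by zero.\<close>
  moreover have "eventually (\<lambda>n. cdf (M n) x = measure_pmf.prob (P_unif n)
      {\<pi>. ln (real (N_inv n \<pi>)) \<le> mu_seq n + x * sigma_seq n}) sequentially"
    using eventually_ge_at_top[of 2]
  proof eventually_elim
    case (elim n)
    have "0 < sqrt (ln n ^ 3 / 6)" using elim by simp
    also have "\<dots> \<le> sigma_seq n" using elim by (intro sigma_seq_ge) simp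
    finally have "X n -` {..x} = {\<pi>. ln (real (N_inv n \<pi>)) \<le> mu_seq n + x * sigma_seq n}"
      by (auto simp: X_def divide_le_eq)
    then show ?case by (simp add: M_def cdf_def measure_distr)
  qed
  ultimately show ?thesis by (rule Lim_transform_eventually)
qed

end
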